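(* Let $\Lambda\in\{\mathrm{K},\mathrm{GL}\}$, let $\vec r=\langle r_0,\dots,r_{n-1}\rangle$ be a finite tuple of parameters and let $\varphi\in\mathrm{Fm}(p,\vec r)$. Then $\varphi$ is $\Lambda$-additive (with respect to $p$) if and only if $\varphi$ is $\Lambda$-equivalent to a formula from $$A_0=\Bigl\{\bigvee\Delta_0\vee\varkappa \;\Bigm|\; \Delta_0 \text{ a finite subset of } \Delta,\ \varkappa\in\mathrm{Fm}(\vec r)\Bigr\},$$ where $\Delta$ is the set of all $\delta$-formulas (with parameters $\vec r$).
   Context: Modal formulas are built from propositional variables using Boolean connectives, $\bot$, $\top$, $\Diamond$ and $\Box$. The variables $p$ and $q$ are distinct non-parameter variables; parameters are variables distinct from $p$ and $q$. $\mathrm{Fm}(p,\vec r)$ is the set of modal formulas containing no variables other than $p,r_0,\dots,r_{n-1}$; $\mathrm{Fm}(\vec r)$ is the set of modal formulas containing no variables other than $r_0,\dots,r_{n-1}$. A $\delta$-formula is a formula of the form $\delta_{\vec\varkappa}=\varkappa_0\wedge\Diamond(\varkappa_1\wedge\dots\wedge\Diamond(\varkappa_m\wedge p)\dots)$ with $m\ge 0$ and $\varkappa_0,\dots,\varkappa_m\in\mathrm{Fm}(\vec r)$ (for $m=0$ it is $\varkappa_0\wedge p$). For a normal modal logic $\Lambda$, formulas $\varphi,\psi$ are $\Lambda$-equivalent if $\Lambda\vdash\varphi\leftrightarrow\psi$. A formula $\varphi(p,\vec r)$ is $\Lambda$-additive if $\Lambda\vdash\varphi(p\vee q,\vec r)\leftrightarrow\varphi(p,\vec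 r)\vee\varphi(q,\vec r)$. $\mathrm{K}$ is the least normal modal logic and $\mathrm{GL}$ is the G\"odel--L\"ob logic, $\mathrm{K}$ plus $\Box(\Box p\to p)\to\Box p$. An empty disjunction is $\bot$. *)

theory Defs
  imports Main
begin

text \<open>Modal formulas. All connectives are primitive, except equivalence, which abbreviates the
  conjunction of the two implications.\<close>

datatype fm =
    Var nat
  | Bot (\<open>\<^bold>\<bottom>\<close>)
  | Top (\<open>\<^bold>\<top>\<close>)
  | Neg fm (\<open>\<^bold>\<not> _\<close> [75] 75)
  | And fm fm (infixr \<open>\<^bold>\<and>\<close> 70)
  | Or fm fm (infixr \<open>\<^bold>\<or>\<close> 65)
  | Imp fm fm (infixr \<open>\<^bold>\<longrightarrow>\<close> 60)
  | Dia fm (\<open>\<^bold>\<diamond> _\<close> [75] 75)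
  | Box fm (\<open>\<^bold>\<box> _\<close> [75] 75)

abbreviation Iff :: "fm \<Rightarrow> fm \<Rightarrow> fm" (infix \<open>\<^bold>\<longleftrightarrow>\<close> 58) where
  "\<phi> \<^bold>\<longleftrightarrow> \<psi> \<equiv> (\<phi> \<^bold>\<longrightarrow> \<psi>) \<^bold>\<and> (\<psi> \<^bold>\<longrightarrow> \<phi>)"

primrec vars :: "fm \<Rightarrow> nat set" where
  "vars (Var x) = {x}"
| "vars \<^bold>\<bottom> = {}"
| "vars \<^bold>\<top> = {}"
| "vars (\<^bold>\<not> \<phi>) = vars \<phi>"
| "vars (\<phi> \<^bold>\<and> \<psi>) = vars \<phi> \<union> vars \<psi>"
| "vars (\<phi> \<^bold>\<or> \<psi>) = vars \<phi> \<union> vars \<psi>"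
| "vars (\<phi> \<^bold>\<longrightarrow> \<psi>) = vars \<phi> \<union> vars \<psi>"
| "vars (\<^bold>\<diamond> \<phi>) = vars \<phi>"
| "vars (\<^bold>\<box> \<phi>) = vars \<phi>"

definition Fm :: "nat set \<Rightarrow> fm set" where
  "Fm X = {\<phi>. vars \<phi> \<subseteq> X}"

primrec subst :: "(nat \<Rightarrow> fm) \<Rightarrow> fm \<Rightarrow> fm" where
  "subst \<sigma> (Var x) = \<sigma> x"
| "subst \<sigma> \<^bold>\<bottom> = \<^bold>\<bottom>"
| "subst \<sigma> \<^bold>\<top> = \<^bold>\<top>"
| "subst \<sigma> (\<^bold>\<not> \<phi>) = \<^bold>\<not> subst \<sigma> \<phi>"
| "subst \<sigma> (\<phi> \<^bold>\<and> \<psi>) = subst \<sigma> \<phi> \<^bold>\<and> subst \<sigma> \<psi>"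
| "subst \<sigma> (\<phi> \<^bold>\<or> \<psi>) = subst \<sigma> \<phi> \<^bold>\<or> subst \<sigma> \<psi>"
| "subst \<sigma> (\<phi> \<^bold>\<longrightarrow> \<psi>) = (subst \<sigma> \<phi> \<^bold>\<longrightarrow> subst \<sigma> \<psi>)"
| "subst \<sigma> (\<^bold>\<diamond> \<phi>) = \<^bold>\<diamond> subst \<sigma> \<phi>"
| "subst \<sigma> (\<^bold>\<box> \<phi>) = \<^bold>\<box> subst \<sigma> \<phi>"

text \<open>Classical evaluation in which variables and formulas of the form \<open>\<^bold>\<diamond> \<phi>\<close> or \<open>\<^bold>\<box> \<phi>\<close> all count as
  atoms, so that \<open>tautology\<close> covers the substitution instances of classical tautologies.\<close>

primrec beval :: "(fm \<Rightarrow> bool) \<Rightarrow> fm \<Rightarrow> bool" where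
  "beval v (Var x) \<longleftrightarrow> v (Var x)"
| "beval v \<^bold>\<bottom> \<longleftrightarrow> False"
| "beval v \<^bold>\<top> \<longleftrightarrow> True"
| "beval v (\<^bold>\<not> \<phi>) \<longleftrightarrow> \<not> beval v \<phi>"
| "beval v (\<phi> \<^bold>\<and> \<psi>) \<longleftrightarrow> beval v \<phi> \<and> beval v \<psi>"
| "beval v (\<phi> \<^bold>\<or> \<psi>) \<longleftrightarrow> beval v \<phi> \<or> beval v \<psi>"
| "beval v (\<phi> \<^bold>\<longrightarrow> \<psi>) \<longleftrightarrow> (beval v \<phi> \<longrightarrow> beval v \<psi>)"
| "beval v (\<^bold>\<diamond> \<phi>) \<longleftrightarrow> v (\<^bold>\<diamond> \<phi>)"
| "beval v (\<^bold>\<box> \<phi>) \<longleftrightarrow> v (\<^bold>\<box> \<phi>)"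

definition tautology :: "fm \<Rightarrow> bool" where
  "tautology \<phi> \<longleftrightarrow> (\<forall>v. beval v \<phi>)"

text \<open>A logic is identified with its set of theorems; derivability is membership. As both
  modalities are primitive, their duality is one of the axioms.\<close>

definition normal_modal_logic :: "fm set \<Rightarrow> bool" where
  "normal_modal_logic \<Lambda> \<longleftrightarrow>
     (\<forall>\<phi>. tautology \<phi> \<longrightarrow> \<phi> \<in> \<Lambda>) \<and>
     (\<forall>\<phi> \<psi>. (\<^bold>\<box> (\<phi> \<^bold>\<longrightarrow> \<psi>) \<^bold>\<longrightarrow> \<^bold>\<box> \<phi> \<^bold>\<longrightarrow> \<^bold>\<box> \<psi>) \<in> \<Lambda>) \<and>
     (\<forall>\<phi>. (\<^bold>\<diamond> \<phi> \<^bold>\<longleftrightarrow> \<^bold>\<not> \<^bold>\<box> \<^bold>\<not> \<phi>) \<in> \<Lambda>) \<and>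
     (\<forall>\<phi> \<psi>. \<phi> \<in> \<Lambda> \<longrightarrow> (\<phi> \<^bold>\<longrightarrow> \<psi>) \<in> \<Lambda> \<longrightarrow> \<psi> \<in> \<Lambda>) \<and>
     (\<forall>\<phi>. \<phi> \<in> \<Lambda> \<longrightarrow> \<^bold>\<box> \<phi> \<in> \<Lambda>) \<and>
     (\<forall>\<phi> \<sigma>. \<phi> \<in> \<Lambda> \<longrightarrow> subst \<sigma> \<phi> \<in> \<Lambda>)"

definition least_normal_logic :: "fm set \<Rightarrow> fm set" where
  "least_normal_logic Ax = \<Inter>{\<Lambda>. normal_modal_logic \<Lambda> \<and> Ax \<subseteq> \<Lambda>}"

lemma normal_least_normal_logic: "normal_modal_logic (least_normal_logic Ax)"
  unfolding least_normal_logic_def normal_modal_logic_def by blast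

definition logic_K :: "fm set" where
  "logic_K = least_normal_logic {}"

text \<open>The choice of variable in Loeb's axiom is immaterial, as logics are closed under
  substitution.\<close>

definition logic_GL :: "fm set" where
  "logic_GL = least_normal_logic {\<^bold>\<box> (\<^bold>\<box> (Var 0) \<^bold>\<longrightarrow> Var 0) \<^bold>\<longrightarrow> \<^bold>\<box> (Var 0)}"

definition equivalent :: "fm set \<Rightarrow> fm \<Rightarrow> fm \<Rightarrow> bool" where
  "equivalent \<Lambda> \<phi> \<psi> \<longleftrightarrow> (\<phi> \<^bold>\<longleftrightarrow> \<psi>) \<in> \<Lambda>"

text \<open>Additivity of \<open>\<phi>\<close> in \<open>p\<close>; \<open>q\<close> is meant to be a variable different from \<open>p\<close> that does not
  occur in \<open>\<phi>\<close>.\<close>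

definition additive :: "fm set \<Rightarrow> nat \<Rightarrow> nat \<Rightarrow> fm \<Rightarrow> bool" where
  "additive \<Lambda> p q \<phi> \<longleftrightarrow>
     (subst (Var(p := Var p \<^bold>\<or> Var q)) \<phi> \<^bold>\<longleftrightarrow> \<phi> \<^bold>\<or> subst (Var(p := Var q)) \<phi>) \<in> \<Lambda>"

text \<open>The first formula \<open>\<kappa>\<^sub>0\<close> is a separate argument, so \<open>m\<close> is the length of the list.\<close>

primrec delta :: "nat \<Rightarrow> fm \<Rightarrow> fm list \<Rightarrow> fm" where
  "delta p \<kappa> [] = \<kappa> \<^bold>\<and> Var p"
| "delta p \<kappa> (\<kappa>' # \<kappa>s) = \<kappa> \<^bold>\<and> \<^bold>\<diamond> (delta p \<kappa>' \<kappa>s)"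

definition Delta :: "nat \<Rightarrow> nat set \<Rightarrow> fm set" where
  "Delta p R = {delta p \<kappa> \<kappa>s | \<kappa> \<kappa>s. \<kappa> \<in> Fm R \<and> set \<kappa>s \<subseteq> Fm R}"

definition Disj :: "fm list \<Rightarrow> fm" where
  "Disj \<phi>s = foldr Or \<phi>s \<^bold>\<bottom>"

text \<open>The finite subset \<open>\<Delta>\<^sub>0\<close> is given by an enumeration \<open>\<delta>s\<close>, which also fixes the order in which
  its disjunction is written; all orders are allowed.\<close>

definition A0 :: "nat \<Rightarrow> nat set \<Rightarrow> fm set" where
  "A0 p R = {Disj \<delta>s \<^bold>\<or> \<kappa> | \<delta>s \<kappa>. distinct \<delta>s \<and> set \<delta>s \<subseteq> Delta p R \<and> \<kappa> \<in> Fm R}"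

end

theory Submission
  imports Defs
begin

text \<open>Both logics are sound and complete for finite frames (transitive and conversely well-founded
  ones in the case of GL). In a finite model an additive \<open>\<phi>\<close> that is true remains true when \<open>p\<close> is made
  false everywhere, or false everywhere except at one world. Apply this to an unravelling in which
  every world but the root has a twin: as the twin of the marked world, and the twins of its
  predecessors, stay unmarked, truth of \<open>\<phi>\<close> at the root depends only on which instances of
  subformulas of \<open>\<phi>\<close> with \<open>p\<close> replaced by \<open>\<bottom>\<close> hold along the path to the marked world. Such a path is
  described by a \<open>\<delta>\<close>-formula, which therefore implies \<open>\<phi>\<close>. Finitely many paths suffice: for K the
  modal depth of \<open>\<phi>\<close> bounds their length; for GL a path on which two non-initial worlds agree on
  all subformulas of \<open>\<phi>\<close> can be cut short, because the frame is transitive.\<close>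

section \<open>Kripke semantics\<close>

primrec sat :: "('w \<Rightarrow> 'w \<Rightarrow> bool) \<Rightarrow> ('w \<Rightarrow> nat \<Rightarrow> bool) \<Rightarrow> 'w \<Rightarrow> fm \<Rightarrow> bool" where
  "sat R V w (Var x) \<longleftrightarrow> V w x"
| "sat R V w \<^bold>\<bottom> \<longleftrightarrow> False"
| "sat R V w \<^bold>\<top> \<longleftrightarrow> True"
| "sat R V w (\<^bold>\<not> \<phi>) \<longleftrightarrow> \<not> sat R V w \<phi>"
| "sat R V w (\<phi> \<^bold>\<and> \<psi>) \<longleftrightarrow> sat R V w \<phi> \<and> sat R V w \<psi>"
| "sat R V w (\<phi> \<^bold>\<or> \<psi>) \<longleftrightarrow> sat R V w \<phi> \<or> sat R V w \<psi>"
| "sat R V w (\<phi> \<^bold>\<longrightarrow> \<psi>) \<longleftrightarrow> (sat R V w \<phi> \<longrightarrow> sat R V w \<psi>)"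
| "sat R V w (\<^bold>\<diamond> \<phi>) \<longleftrightarrow> (\<exists>u. R w u \<and> sat R V u \<phi>)"
| "sat R V w (\<^bold>\<box> \<phi>) \<longleftrightarrow> (\<forall>u. R w u \<longrightarrow> sat R V u \<phi>)"

text \<open>The flag \<open>g\<close> is true for GL and false for K; it is carried along everywhere
  so that both logics share one proof.\<close>

definition logic :: "bool \<Rightarrow> fm set" where
  "logic g = (if g then logic_GL else logic_K)"

definition okframe :: "bool \<Rightarrow> ('w \<Rightarrow> 'w \<Rightarrow> bool) \<Rightarrow> bool" where
  "okframe g R \<longleftrightarrow> (g \<longrightarrow> transp R \<and> wfp (R\<inverse>\<inverse>))"

lemma sat_subst: "sat R V w (subst \<sigma> \<phi>) = sat R (\<lambda>u x. sat R V u (\<sigma> x)) w \<phi>"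
  by (induction \<phi> arbitrary: w) auto

lemma sat_cong:
  "(\<And>u x. x \<in> vars \<phi> \<Longrightarrow> V u x = V' u x) \<Longrightarrow> sat R V w \<phi> = sat R V' w \<phi>"
  by (induction \<phi> arbitrary: w) auto

lemma beval_sat: "beval (sat R V w) \<phi> = sat R V w \<phi>"
  by (induction \<phi>) auto

text \<open>Together with the minimality of the least normal logic this reduces soundness to the
  validity of the extra axiom.\<close>

lemma normal_valid:
  "normal_modal_logic {\<phi>. \<forall>(R :: 'w \<Rightarrow> 'w \<Rightarrow> bool) V w. okframe g R \<longrightarrow> sat R V w \<phi>}"
  unfolding normal_modal_logic_def
proof (intro conjI allI impI CollectI, goal_cases)
  case (1 \<phi> R V w)
  then show ?case unfolding tautology_def by (simp flip: beval_sat)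
next
  case (4 \<phi> \<psi> R V w)
  then have "sat R V w \<phi>" "sat R V w (\<phi> \<^bold>\<longrightarrow> \<psi>)" by simp_all
  then show ?case by simp
qed (simp_all add: sat_subst)

text \<open>Induction along the converse of \<open>R\<close>: by transitivity the successors of a
  successor \<open>u\<close> of \<open>w\<close> are successors of \<open>w\<close>, so they satisfy
  \<phi> by the induction hypothesis, and the premise of the axiom carries \<phi> to
  \<open>u\<close>.\<close>

lemma sat_Loeb:
  assumes "transp R" "wfp (R\<inverse>\<inverse>)"
  shows "sat R V w (\<^bold>\<box> (\<^bold>\<box> \<phi> \<^bold>\<longrightarrow> \<phi>) \<^bold>\<longrightarrow> \<^bold>\<box> \<phi>)"
proof -
  have "sat R V u \<phi>"
    if step: "\<forall>v. R w v \<longrightarrow> (\<forall>u. R v u \<longrightarrow> sat R V u \<phi>) \<longrightarrow> sat R V v \<phi>" and "R w u" for u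
    using assms(2) \<open>R w u\<close>
  proof (induction u rule: wfp_induct_rule)
    case (less u)
    have "\<forall>v. R u v \<longrightarrow> sat R V v \<phi>"
      using less transpD[OF assms(1)] by blast
    with step less.prems show ?case by blast
  qed
  then show ?thesis unfolding sat.simps by blast
qed

lemma least_normal_logic_subset:
  "normal_modal_logic \<Lambda> \<Longrightarrow> Ax \<subseteq> \<Lambda> \<Longrightarrow> least_normal_logic Ax \<subseteq> \<Lambda>"
  unfolding least_normal_logic_def by blast

lemma soundness:
  fixes R :: "'w \<Rightarrow> 'w \<Rightarrow> bool"
  assumes "\<phi> \<in> logic g" "okframe g R"
  shows "sat R V w \<phi>"
proof -
  let ?L = "{\<phi>. \<forall>(R :: 'w \<Rightarrow> 'w \<Rightarrow> bool) V w. okframe g R \<longrightarrow> sat R V w \<phi>}"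
  have "logic g \<subseteq> ?L"
  proof (cases g)
    case True
    then have "{\<^bold>\<box> (\<^bold>\<box> (Var 0) \<^bold>\<longrightarrow> Var 0) \<^bold>\<longrightarrow> \<^bold>\<box> (Var 0)} \<subseteq> ?L"
      by (simp add: okframe_def del: sat.simps) (blast intro: sat_Loeb)
    then show ?thesis
      unfolding logic_def logic_GL_def if_P[OF True] by (rule least_normal_logic_subset[OF normal_valid])
  next
    case False
    show ?thesis
      unfolding logic_def logic_K_def if_not_P[OF False]
      by (rule least_normal_logic_subset[OF normal_valid empty_subsetI])
  qed
  with assms show ?thesis by blast
qed

section \<open>Completeness for finite frames\<close>

primrec subs :: "fm \<Rightarrow> fm list" where
  "subs (Var x) = [Var x]"
| "subs \<^bold>\<bottom> = [\<^bold>\<bottom>]"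
| "subs \<^bold>\<top> = [\<^bold>\<top>]"
| "subs (\<^bold>\<not> \<phi>) = (\<^bold>\<not> \<phi>) # subs \<phi>"
| "subs (\<phi> \<^bold>\<and> \<psi>) = (\<phi> \<^bold>\<and> \<psi>) # subs \<phi> @ subs \<psi>"
| "subs (\<phi> \<^bold>\<or> \<psi>) = (\<phi> \<^bold>\<or> \<psi>) # subs \<phi> @ subs \<psi>"
| "subs (\<phi> \<^bold>\<longrightarrow> \<psi>) = (\<phi> \<^bold>\<longrightarrow> \<psi>) # subs \<phi> @ subs \<psi>"
| "subs (\<^bold>\<diamond> \<phi>) = (\<^bold>\<diamond> \<phi>) # subs \<phi>"
| "subs (\<^bold>\<box> \<phi>) = (\<^bold>\<box> \<phi>) # subs \<phi>"

lemma subs_self: "\<phi> \<in> set (subs \<phi>)"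
  by (cases \<phi>) auto

lemma subs_trans: "\<psi> \<in> set (subs \<phi>) \<Longrightarrow> \<chi> \<in> set (subs \<psi>) \<Longrightarrow> \<chi> \<in> set (subs \<phi>)"
  by (induction \<phi>) auto

lemma subs_closed:
  "\<^bold>\<not> \<psi> \<in> set (subs \<phi>) \<Longrightarrow> \<psi> \<in> set (subs \<phi>)"
  "\<psi> \<^bold>\<and> \<chi> \<in> set (subs \<phi>) \<Longrightarrow> \<psi> \<in> set (subs \<phi>) \<and> \<chi> \<in> set (subs \<phi>)"
  "\<psi> \<^bold>\<or> \<chi> \<in> set (subs \<phi>) \<Longrightarrow> \<psi> \<in> set (subs \<phi>) \<and> \<chi> \<in> set (subs \<phi>)"
  "(\<psi> \<^bold>\<longrightarrow> \<chi>) \<in> set (subs \<phi>) \<Longrightarrow> \<psi> \<in> set (subs \<phi>) \<and> \<chi> \<in> set (subs \<phi>)"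
  "\<^bold>\<diamond> \<psi> \<in> set (subs \<phi>) \<Longrightarrow> \<psi> \<in> set (subs \<phi>)"
  by ((intro conjI)?; erule subs_trans; simp add: subs_self)+

text \<open>The state description of \<open>X\<close> relative to \<open>\<phi>s\<close>. It serves
  twice: for the consistency of canonical worlds, and for the parameter formulas inside the
  \<delta>-formulas.\<close>

definition char_fm :: "fm list \<Rightarrow> fm set \<Rightarrow> fm" where
  "char_fm \<phi>s X = foldr And (map (\<lambda>\<chi>. if \<chi> \<in> X then \<chi> else \<^bold>\<not> \<chi>) \<phi>s) \<^bold>\<top>"

lemma beval_char_fm: "beval v (char_fm \<phi>s X) \<longleftrightarrow> (\<forall>\<chi>\<in>set \<phi>s. beval v \<chi> \<longleftrightarrow> \<chi> \<in> X)"
  by (induction \<phi>s) (auto simp: char_fm_def)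

lemma sat_char_fm: "sat R V w (char_fm \<phi>s X) \<longleftrightarrow> (\<forall>\<chi>\<in>set \<phi>s. sat R V w \<chi> \<longleftrightarrow> \<chi> \<in> X)"
  by (induction \<phi>s) (auto simp: char_fm_def)

section \<open>Derivations in a normal modal logic\<close>

context
  fixes \<Lambda> :: "fm set"
  assumes normal: "normal_modal_logic \<Lambda>"
begin

lemma taut: "tautology \<phi> \<Longrightarrow> \<phi> \<in> \<Lambda>"
  and box_distrib: "(\<^bold>\<box> (\<phi> \<^bold>\<longrightarrow> \<psi>) \<^bold>\<longrightarrow> \<^bold>\<box> \<phi> \<^bold>\<longrightarrow> \<^bold>\<box> \<psi>) \<in> \<Lambda>"
  and dual: "(\<^bold>\<diamond> \<phi> \<^bold>\<longleftrightarrow> \<^bold>\<not> \<^bold>\<box> \<^bold>\<not> \<phi>) \<in> \<Lambda>"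
  and mp: "\<phi> \<in> \<Lambda> \<Longrightarrow> (\<phi> \<^bold>\<longrightarrow> \<psi>) \<in> \<Lambda> \<Longrightarrow> \<psi> \<in> \<Lambda>"
  and nec: "\<phi> \<in> \<Lambda> \<Longrightarrow> \<^bold>\<box> \<phi> \<in> \<Lambda>"
  using normal unfolding normal_modal_logic_def by blast+

text \<open>Premises become antecedents one by one until a tautology remains. Propositional
  derivations in \<Lambda> are thereby replaced by arguments about \<open>beval\<close>.\<close>

lemma prop_consequence:
  "finite S \<Longrightarrow> S \<subseteq> \<Lambda> \<Longrightarrow> (\<And>v. \<forall>\<chi>\<in>S. beval v \<chi> \<Longrightarrow> beval v \<phi>) \<Longrightarrow> \<phi> \<in> \<Lambda>"
proof (induction S arbitrary: \<phi> rule: finite_induct)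
  case empty
  then show ?case by (intro taut) (auto simp: tautology_def)
next
  case (insert \<psi> S)
  have "(\<psi> \<^bold>\<longrightarrow> \<phi>) \<in> \<Lambda>"
    using insert.prems by (intro insert.IH) auto
  then show ?case using insert.prems mp by blast
qed

text \<open>The same device below a box: each member of \<open>H\<close> becomes an antecedent there
  and is discharged by distributing the box; the theorems in \<open>S\<close> enter by
  necessitation.\<close>

lemma box_consequence:
  assumes "finite S" "S \<subseteq> \<Lambda>" "finite H"
    and "\<And>\<chi>. \<chi> \<in> H \<Longrightarrow> (\<alpha> \<^bold>\<longrightarrow> \<^bold>\<box> \<chi>) \<in> \<Lambda>"
    and "\<And>v. \<forall>\<chi>\<in>S \<union> H. beval v \<chi> \<Longrightarrow> beval v \<phi>"
  shows "(\<alpha> \<^bold>\<longrightarrow> \<^bold>\<box> \<phi>) \<in> \<Lambda>"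
  using assms(3-5)
proof (induction H arbitrary: \<phi> rule: finite_induct)
  case empty
  then have "\<^bold>\<box> \<phi> \<in> \<Lambda>"
    using prop_consequence[OF assms(1,2)] nec by simp
  then show ?case by (intro prop_consequence[of "{\<^bold>\<box> \<phi>}"]) auto
next
  case (insert \<psi> H)
  have "(\<alpha> \<^bold>\<longrightarrow> \<^bold>\<box> (\<psi> \<^bold>\<longrightarrow> \<phi>)) \<in> \<Lambda>"
  proof (rule insert.IH)
    show "(\<alpha> \<^bold>\<longrightarrow> \<^bold>\<box> \<chi>) \<in> \<Lambda>" if "\<chi> \<in> H" for \<chi>
      using insert.prems(1) that by blast
    show "beval v (\<psi> \<^bold>\<longrightarrow> \<phi>)" if "\<forall>\<chi>\<in>S \<union> H. beval v \<chi>" for v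
      using insert.prems(2)[of v] that by simp
  qed
  moreover have "(\<alpha> \<^bold>\<longrightarrow> \<^bold>\<box> \<psi>) \<in> \<Lambda>"
    using insert.prems(1) by blast
  ultimately show ?case
    using box_distrib[of \<psi> \<phi>]
    by (intro prop_consequence[of "{\<alpha> \<^bold>\<longrightarrow> \<^bold>\<box> (\<psi> \<^bold>\<longrightarrow> \<phi>), \<alpha> \<^bold>\<longrightarrow> \<^bold>\<box> \<psi>, \<^bold>\<box> (\<psi> \<^bold>\<longrightarrow> \<phi>) \<^bold>\<longrightarrow> \<^bold>\<box> \<psi> \<^bold>\<longrightarrow> \<^bold>\<box> \<phi>}"]) auto
qed

text \<open>Finite analogues of maximal consistent sets: a world decides every member of \<Gamma>,
  absence standing for negation.\<close>

definition worlds :: "fm list \<Rightarrow> fm set set" where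
  "worlds \<Gamma> = {X. X \<subseteq> set \<Gamma> \<and> (\<^bold>\<not> char_fm \<Gamma> X) \<notin> \<Lambda>}"

lemma finite_worlds: "finite (worlds \<Gamma>)"
  unfolding worlds_def by (rule finite_subset[of _ "Pow (set \<Gamma>)"]) auto

text \<open>A consistent state description is not refuted by tautologies alone. The valuation
  supplies the Boolean cases of the truth lemma.\<close>

lemma world_valuation:
  assumes "X \<in> worlds \<Gamma>"
  obtains v where "X = {\<chi> \<in> set \<Gamma>. beval v \<chi>}"
proof -
  have "\<not> tautology (\<^bold>\<not> char_fm \<Gamma> X)"
    using assms taut unfolding worlds_def by blast
  then obtain v where "\<forall>\<chi>\<in>set \<Gamma>. beval v \<chi> \<longleftrightarrow> \<chi> \<in> X"
    unfolding tautology_def by (auto simp: beval_char_fm)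
  then show thesis using assms that[of v] unfolding worlds_def by auto
qed

text \<open>The finitely many theorems that exclude subsets of \<Gamma> as worlds; a valuation
  satisfying them all picks out a world.\<close>

definition inconsistencies :: "fm list \<Rightarrow> fm set" where
  "inconsistencies \<Gamma> = {\<^bold>\<not> char_fm \<Gamma> Y | Y. Y \<subseteq> set \<Gamma> \<and> (\<^bold>\<not> char_fm \<Gamma> Y) \<in> \<Lambda>}"

lemma inconsistencies: "finite (inconsistencies \<Gamma>)" "inconsistencies \<Gamma> \<subseteq> \<Lambda>"
  unfolding inconsistencies_def by auto

lemma valuation_world:
  assumes "\<forall>\<chi>\<in>inconsistencies \<Gamma>. beval v \<chi>"
  shows "{\<chi> \<in> set \<Gamma>. beval v \<chi>} \<in> worlds \<Gamma>"
proof (rule ccontr)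
  let ?Y = "{\<chi> \<in> set \<Gamma>. beval v \<chi>}"
  assume "?Y \<notin> worlds \<Gamma>"
  then have "(\<^bold>\<not> char_fm \<Gamma> ?Y) \<in> inconsistencies \<Gamma>"
    unfolding worlds_def inconsistencies_def by auto
  with assms have "beval v (\<^bold>\<not> char_fm \<Gamma> ?Y)" by blast
  then show False by (auto simp: beval_char_fm)
qed

text \<open>If every valuation satisfying \<open>inconsistencies \<Gamma>\<close> made \<phi> true,
  then \<phi> would follow propositionally from theorems.\<close>

lemma world_existence:
  assumes "\<phi> \<notin> \<Lambda>" "\<phi> \<in> set \<Gamma>"
  obtains X where "X \<in> worlds \<Gamma>" "\<phi> \<notin> X"
proof -
  obtain v where v: "\<forall>\<chi>\<in>inconsistencies \<Gamma>. beval v \<chi>" "\<not> beval v \<phi>"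
    using prop_consequence[OF inconsistencies] assms(1) by blast
  show thesis
    by (rule that[OF valuation_world[OF v(1)]]) (use v(2) in auto)
qed

text \<open>Otherwise theorems and \<open>H\<close> would imply \<not>\<theta>, so the state
  description of \<open>X\<close> would imply \<box>\<not>\<theta> and be inconsistent. A valuation
  is returned, not just a world, because \<theta> and members of \<open>H\<close> may lie outside
  \<Gamma>.\<close>

lemma successor_existence:
  assumes "X \<in> worlds \<Gamma>" "finite H"
    and "\<And>\<chi>. \<chi> \<in> H \<Longrightarrow> (char_fm \<Gamma> X \<^bold>\<longrightarrow> \<^bold>\<box> \<chi>) \<in> \<Lambda>"
    and "(char_fm \<Gamma> X \<^bold>\<longrightarrow> \<^bold>\<not> \<^bold>\<box> \<^bold>\<not> \<theta>) \<in> \<Lambda>"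
  obtains v where "{\<chi> \<in> set \<Gamma>. beval v \<chi>} \<in> worlds \<Gamma>" "\<forall>\<chi>\<in>H. beval v \<chi>" "beval v \<theta>"
proof -
  have "\<exists>v. (\<forall>\<chi>\<in>inconsistencies \<Gamma> \<union> H. beval v \<chi>) \<and> beval v \<theta>"
  proof (rule ccontr)
    assume *: "\<not> ?thesis"
    have "(char_fm \<Gamma> X \<^bold>\<longrightarrow> \<^bold>\<box> \<^bold>\<not> \<theta>) \<in> \<Lambda>"
      by (rule box_consequence[OF inconsistencies assms(2,3)]) (use * in auto)
    with assms(4) have "(\<^bold>\<not> char_fm \<Gamma> X) \<in> \<Lambda>"
      by (intro prop_consequence[of "{char_fm \<Gamma> X \<^bold>\<longrightarrow> \<^bold>\<box> \<^bold>\<not> \<theta>, char_fm \<Gamma> X \<^bold>\<longrightarrow> \<^bold>\<not> \<^bold>\<box> \<^bold>\<not> \<theta>}"]) auto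
    with assms(1) show False unfolding worlds_def by blast
  qed
  then show thesis using that valuation_world by blast
qed

lemma char_fm_imp:
  assumes "\<chi> \<in> set \<Gamma>" "((if \<chi> \<in> X then \<chi> else \<^bold>\<not> \<chi>) \<^bold>\<longrightarrow> \<phi>) \<in> \<Lambda>"
  shows "(char_fm \<Gamma> X \<^bold>\<longrightarrow> \<phi>) \<in> \<Lambda>"
proof (rule prop_consequence[of "{(if \<chi> \<in> X then \<chi> else \<^bold>\<not> \<chi>) \<^bold>\<longrightarrow> \<phi>}"])
  show "beval v (char_fm \<Gamma> X \<^bold>\<longrightarrow> \<phi>)"
    if "\<forall>\<chi>\<in>{(if \<chi> \<in> X then \<chi> else \<^bold>\<not> \<chi>) \<^bold>\<longrightarrow> \<phi>}. beval v \<chi>" for v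
    using that assms(1) by (cases "\<chi> \<in> X") (auto simp: beval_char_fm)
qed (use assms(2) in simp_all)

lemma neg_dia: "(\<^bold>\<not> \<^bold>\<diamond> \<phi> \<^bold>\<longrightarrow> \<^bold>\<box> \<^bold>\<not> \<phi>) \<in> \<Lambda>"
  by (rule prop_consequence[of "{\<^bold>\<diamond> \<phi> \<^bold>\<longleftrightarrow> \<^bold>\<not> \<^bold>\<box> \<^bold>\<not> \<phi>}"]) (auto simp: dual)

lemma neg_box: "(\<^bold>\<not> \<^bold>\<box> \<phi> \<^bold>\<longrightarrow> \<^bold>\<not> \<^bold>\<box> \<^bold>\<not> \<^bold>\<not> \<phi>) \<in> \<Lambda>"
proof -
  have "(\<^bold>\<box> \<^bold>\<not> \<^bold>\<not> \<phi> \<^bold>\<longrightarrow> \<^bold>\<box> \<phi>) \<in> \<Lambda>"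
    by (rule box_consequence[of "{}" "{\<^bold>\<not> \<^bold>\<not> \<phi>}"]) (auto intro: taut simp: tautology_def)
  then show ?thesis
    by (intro prop_consequence[of "{\<^bold>\<box> \<^bold>\<not> \<^bold>\<not> \<phi> \<^bold>\<longrightarrow> \<^bold>\<box> \<phi>}"]) auto
qed

section \<open>Consequences of Loeb's axiom\<close>

context
  assumes Loeb: "\<And>\<phi>. (\<^bold>\<box> (\<^bold>\<box> \<phi> \<^bold>\<longrightarrow> \<phi>) \<^bold>\<longrightarrow> \<^bold>\<box> \<phi>) \<in> \<Lambda>"
begin

text \<open>The classical derivation of transitivity: Loeb's axiom is applied to the conjunction of
  \<phi> and \<box>\<phi>.\<close>

lemma box_four: "(\<^bold>\<box> \<phi> \<^bold>\<longrightarrow> \<^bold>\<box> \<^bold>\<box> \<phi>) \<in> \<Lambda>"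
proof -
  let ?B = "\<phi> \<^bold>\<and> \<^bold>\<box> \<phi>"
  have self: "(\<psi> \<^bold>\<longrightarrow> \<psi>) \<in> \<Lambda>" for \<psi>
    by (intro taut) (auto simp: tautology_def)
  have 1: "(\<^bold>\<box> ?B \<^bold>\<longrightarrow> \<^bold>\<box> \<phi>) \<in> \<Lambda>"
    by (rule box_consequence[of "{}" "{?B}"]) (auto intro: self)
  have 2: "(\<^bold>\<box> \<phi> \<^bold>\<longrightarrow> \<^bold>\<box> (\<^bold>\<box> ?B \<^bold>\<longrightarrow> ?B)) \<in> \<Lambda>"
    by (rule box_consequence[of "{\<^bold>\<box> ?B \<^bold>\<longrightarrow> \<^bold>\<box> \<phi>}" "{\<phi>}"]) (auto intro: self 1)
  have 3: "(\<^bold>\<box> ?B \<^bold>\<longrightarrow> \<^bold>\<box> \<^bold>\<box> \<phi>) \<in> \<Lambda>"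
    by (rule box_consequence[of "{}" "{?B}"]) (auto intro: self)
  show ?thesis
    by (rule prop_consequence[of "{\<^bold>\<box> \<phi> \<^bold>\<longrightarrow> \<^bold>\<box> (\<^bold>\<box> ?B \<^bold>\<longrightarrow> ?B), \<^bold>\<box> (\<^bold>\<box> ?B \<^bold>\<longrightarrow> ?B) \<^bold>\<longrightarrow> \<^bold>\<box> ?B, \<^bold>\<box> ?B \<^bold>\<longrightarrow> \<^bold>\<box> \<^bold>\<box> \<phi>}"])
      (use 2 3 Loeb in auto)
qed

lemma neg_dia_four: "(\<^bold>\<not> \<^bold>\<diamond> \<phi> \<^bold>\<longrightarrow> \<^bold>\<box> \<^bold>\<not> \<^bold>\<diamond> \<phi>) \<in> \<Lambda>"
proof (rule box_consequence[of "{\<^bold>\<diamond> \<phi> \<^bold>\<longleftrightarrow> \<^bold>\<not> \<^bold>\<box> \<^bold>\<not> \<phi>}" "{\<^bold>\<box> \<^bold>\<not> \<phi>}"])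
  show "(\<^bold>\<not> \<^bold>\<diamond> \<phi> \<^bold>\<longrightarrow> \<^bold>\<box> \<chi>) \<in> \<Lambda>" if "\<chi> \<in> {\<^bold>\<box> \<^bold>\<not> \<phi>}" for \<chi>
    by (rule prop_consequence[of "{\<^bold>\<not> \<^bold>\<diamond> \<phi> \<^bold>\<longrightarrow> \<^bold>\<box> \<^bold>\<not> \<phi>, \<^bold>\<box> \<^bold>\<not> \<phi> \<^bold>\<longrightarrow> \<^bold>\<box> \<^bold>\<box> \<^bold>\<not> \<phi>}"])
      (use that neg_dia box_four in auto)
qed (auto simp: dual)

text \<open>Loeb's axiom read contrapositively: a failure of \<box>\<phi> has a last counterexample,
  beyond which \<phi> holds. Such witnesses will make canonical successors strict.\<close>

lemma neg_box_Loeb: "(\<^bold>\<not> \<^bold>\<box> \<phi> \<^bold>\<longrightarrow> \<^bold>\<not> \<^bold>\<box> \<^bold>\<not> (\<^bold>\<not> \<phi> \<^bold>\<and> \<^bold>\<box> \<phi>)) \<in> \<Lambda>"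
proof -
  let ?A = "\<^bold>\<not> (\<^bold>\<not> \<phi> \<^bold>\<and> \<^bold>\<box> \<phi>)"
  have "(\<^bold>\<box> ?A \<^bold>\<longrightarrow> \<^bold>\<box> (\<^bold>\<box> \<phi> \<^bold>\<longrightarrow> \<phi>)) \<in> \<Lambda>"
    by (rule box_consequence[of "{}" "{?A}"]) (auto intro: taut simp: tautology_def)
  then show ?thesis
    by (intro prop_consequence[of "{\<^bold>\<box> ?A \<^bold>\<longrightarrow> \<^bold>\<box> (\<^bold>\<box> \<phi> \<^bold>\<longrightarrow> \<phi>), \<^bold>\<box> (\<^bold>\<box> \<phi> \<^bold>\<longrightarrow> \<phi>) \<^bold>\<longrightarrow> \<^bold>\<box> \<phi>}"])
      (use Loeb in auto)
qed

text \<open>The same for diamonds, from Loeb's axiom for \<not>\<phi>.\<close>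

lemma dia_Loeb: "(\<^bold>\<diamond> \<phi> \<^bold>\<longrightarrow> \<^bold>\<not> \<^bold>\<box> \<^bold>\<not> (\<phi> \<^bold>\<and> \<^bold>\<not> \<^bold>\<diamond> \<phi>)) \<in> \<Lambda>"
proof -
  let ?A = "\<^bold>\<not> (\<phi> \<^bold>\<and> \<^bold>\<not> \<^bold>\<diamond> \<phi>)" and ?B = "\<^bold>\<box> \<^bold>\<not> \<phi> \<^bold>\<longrightarrow> \<^bold>\<not> \<phi>"
  have "(\<^bold>\<box> ?A \<^bold>\<longrightarrow> \<^bold>\<box> ?B) \<in> \<Lambda>"
    by (rule box_consequence[of "{\<^bold>\<diamond> \<phi> \<^bold>\<longleftrightarrow> \<^bold>\<not> \<^bold>\<box> \<^bold>\<not> \<phi>}" "{?A}"])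
      (use dual in \<open>auto intro: taut simp: tautology_def\<close>)
  then show ?thesis
    by (intro prop_consequence[of "{\<^bold>\<box> ?A \<^bold>\<longrightarrow> \<^bold>\<box> ?B, \<^bold>\<box> ?B \<^bold>\<longrightarrow> \<^bold>\<box> \<^bold>\<not> \<phi>, \<^bold>\<diamond> \<phi> \<^bold>\<longleftrightarrow> \<^bold>\<not> \<^bold>\<box> \<^bold>\<not> \<phi>}"])
      (use Loeb dual in auto)
qed

end

text \<open>Without \<open>g\<close> this is the ordinary canonical relation. With \<open>g\<close>,
  the persistence of boxes and of failing diamonds gives transitivity, and the last clause gives
  irreflexivity. Diamonds have their own clauses because \<Gamma> need not contain the dual
  boxes.\<close>

definition canon :: "bool \<Rightarrow> fm list \<Rightarrow> fm set \<Rightarrow> fm set \<Rightarrow> bool" where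
  "canon g \<Gamma> X Y \<longleftrightarrow> X \<in> worlds \<Gamma> \<and> Y \<in> worlds \<Gamma> \<and>
     (\<forall>\<chi>. \<^bold>\<box> \<chi> \<in> X \<longrightarrow> \<chi> \<in> Y \<and> (g \<longrightarrow> \<^bold>\<box> \<chi> \<in> Y)) \<and>
     (\<forall>\<chi>. \<^bold>\<diamond> \<chi> \<in> set \<Gamma> - X \<longrightarrow> \<chi> \<notin> Y \<and> (g \<longrightarrow> \<^bold>\<diamond> \<chi> \<notin> Y)) \<and>
     (g \<longrightarrow> (\<exists>\<chi>. \<^bold>\<box> \<chi> \<in> Y - X \<or> \<^bold>\<diamond> \<chi> \<in> X - Y))"

text \<open>A transitive irreflexive relation on a finite set is conversely well-founded.\<close>

lemma okframe_canon: "okframe g (canon g \<Gamma>)"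
  unfolding okframe_def
proof (intro impI conjI)
  assume g
  have sub: "X \<subseteq> set \<Gamma>" if "X \<in> worlds \<Gamma>" for X
    using that unfolding worlds_def by blast
  \<comment> \<open>A box gained or a diamond lost in the first step stays so in the second, hence
    strictness composes.\<close>
  show trans: "transp (canon g \<Gamma>)"
    using \<open>g\<close> sub unfolding transp_def canon_def by blast
  let ?r = "{(X, Y). canon g \<Gamma> X Y}"
  have "?r \<subseteq> worlds \<Gamma> \<times> worlds \<Gamma>"
    unfolding canon_def by auto
  then have "finite ?r"
    using finite_worlds finite_subset by blast
  moreover have "trans ?r"
    using trans unfolding trans_def transp_def by blast
  moreover have "(X, X) \<notin> ?r" for X
    using \<open>g\<close> unfolding canon_def by blast
  ultimately have "finite ?r" "acyclic ?r"
    unfolding acyclic_def by (simp_all add: trancl_id)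
  then have "wf (?r\<inverse>)"
    by (rule finite_acyclic_wf_converse)
  moreover have "?r\<inverse> = {(X, Y). (canon g \<Gamma>)\<inverse>\<inverse> X Y}"
    by auto
  ultimately show "wfp ((canon g \<Gamma>)\<inverse>\<inverse>)"
    by (simp add: wfp_def)
qed

section \<open>The truth lemma\<close>

context
  fixes g \<Gamma>
  assumes Loeb: "\<And>\<phi>. g \<Longrightarrow> (\<^bold>\<box> (\<^bold>\<box> \<phi> \<^bold>\<longrightarrow> \<phi>) \<^bold>\<longrightarrow> \<^bold>\<box> \<phi>) \<in> \<Lambda>"
    and closed: "\<And>\<chi> \<psi>. \<chi> \<in> set \<Gamma> \<Longrightarrow> \<psi> \<in> set (subs \<chi>) \<Longrightarrow> \<psi> \<in> set \<Gamma>"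
begin

text \<open>The common part of the diamond and box cases: \<theta> is the property wanted of the
  successor, and for GL \<open>strict\<close> asks that \<theta> itself bring about the strict
  change.\<close>

lemma canon_successor:
  assumes X: "X \<in> worlds \<Gamma>"
    and \<theta>: "(char_fm \<Gamma> X \<^bold>\<longrightarrow> \<^bold>\<not> \<^bold>\<box> \<^bold>\<not> \<theta>) \<in> \<Lambda>"
    and strict: "\<And>v. g \<Longrightarrow> beval v \<theta> \<Longrightarrow>
      (\<exists>\<chi>. \<^bold>\<box> \<chi> \<in> set \<Gamma> - X \<and> beval v (\<^bold>\<box> \<chi>)) \<or> (\<exists>\<chi>. \<^bold>\<diamond> \<chi> \<in> X \<and> \<not> beval v (\<^bold>\<diamond> \<chi>))"
  shows "\<exists>v. canon g \<Gamma> X {\<chi> \<in> set \<Gamma>. beval v \<chi>} \<and> beval v \<theta>"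
proof -
  let ?B = "{\<chi>. \<^bold>\<box> \<chi> \<in> X}" and ?D = "{\<chi>. \<^bold>\<diamond> \<chi> \<in> set \<Gamma> - X}"
  \<comment> \<open>All that \<open>canon\<close> demands of a successor apart from strictness. The
    modal members, present for GL only, are boxed consequences of \<open>X\<close> by
    transitivity.\<close>
  let ?H = "?B \<union> Neg ` ?D \<union> (if g then Box ` ?B \<union> (\<lambda>\<chi>. \<^bold>\<not> \<^bold>\<diamond> \<chi>) ` ?D else {})"
  have sub: "X \<subseteq> set \<Gamma>"
    using X unfolding worlds_def by blast
  have BD: "?B \<subseteq> set \<Gamma>" "?D \<subseteq> set \<Gamma>"
    using sub closed subs_self by fastforce+
  then have fin: "finite ?B" "finite ?D"
    using finite_subset by blast+
  then have finH: "finite ?H"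
    by simp
  have boxH: "(char_fm \<Gamma> X \<^bold>\<longrightarrow> \<^bold>\<box> \<chi>) \<in> \<Lambda>" if \<chi>: "\<chi> \<in> ?H" for \<chi>
  proof -
    consider "\<chi> \<in> ?B" | \<psi> where "\<psi> \<in> ?D" "\<chi> = \<^bold>\<not> \<psi>" | \<psi> where g "\<psi> \<in> ?B" "\<chi> = \<^bold>\<box> \<psi>"
      | \<psi> where g "\<psi> \<in> ?D" "\<chi> = \<^bold>\<not> \<^bold>\<diamond> \<psi>"
      using \<chi> by (auto split: if_splits)
    then show ?thesis
    proof cases
      case 1
      then show ?thesis
        using sub by (intro char_fm_imp[of "\<^bold>\<box> \<chi>"]) (auto intro: taut simp: tautology_def)
    next
      case 2
      then show ?thesis
        using neg_dia by (intro char_fm_imp[of "\<^bold>\<diamond> \<psi>"]) auto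
    next
      case 3
      then show ?thesis
        using sub box_four[OF Loeb] by (intro char_fm_imp[of "\<^bold>\<box> \<psi>"]) auto
    next
      case 4
      then show ?thesis
        using neg_dia_four[OF Loeb] by (intro char_fm_imp[of "\<^bold>\<diamond> \<psi>"]) auto
    qed
  qed
  obtain v where v: "{\<chi> \<in> set \<Gamma>. beval v \<chi>} \<in> worlds \<Gamma>" "\<forall>\<chi>\<in>?H. beval v \<chi>" "beval v \<theta>"
    by (rule successor_existence[OF X finH boxH \<theta>])
  have box: "beval v \<chi> \<and> (g \<longrightarrow> beval v (\<^bold>\<box> \<chi>))" if "\<^bold>\<box> \<chi> \<in> X" for \<chi>
  proof -
    from that have "\<chi> \<in> ?H" "g \<longrightarrow> \<^bold>\<box> \<chi> \<in> ?H" by auto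
    then show ?thesis using v(2) by blast
  qed
  have dia: "\<not> beval v \<chi> \<and> (g \<longrightarrow> \<not> beval v (\<^bold>\<diamond> \<chi>))" if "\<^bold>\<diamond> \<chi> \<in> set \<Gamma> - X" for \<chi>
  proof -
    from that have "\<^bold>\<not> \<chi> \<in> ?H" "g \<longrightarrow> (\<^bold>\<not> \<^bold>\<diamond> \<chi>) \<in> ?H" by auto
    then have "beval v (\<^bold>\<not> \<chi>)" "g \<longrightarrow> beval v (\<^bold>\<not> \<^bold>\<diamond> \<chi>)" using v(2) by blast+
    then show ?thesis by simp
  qed
  have "canon g \<Gamma> X {\<chi> \<in> set \<Gamma>. beval v \<chi>}"
    unfolding canon_def
    using X v(1) box dia strict[OF _ v(3)] BD sub by blast
  then show ?thesis using v(3) by blast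
qed

lemma truth:
  "\<psi> \<in> set \<Gamma> \<Longrightarrow> X \<in> worlds \<Gamma> \<Longrightarrow> sat (canon g \<Gamma>) (\<lambda>X x. Var x \<in> X) X \<psi> \<longleftrightarrow> \<psi> \<in> X"
proof (induction \<psi> arbitrary: X)
  case (Dia \<psi>)
  have mem: "\<psi> \<in> set \<Gamma>"
    using Dia.prems(1) closed subs_self by fastforce
  have "\<exists>Y. canon g \<Gamma> X Y \<and> \<psi> \<in> Y" if in_X: "\<^bold>\<diamond> \<psi> \<in> X"
  proof (cases g)
    case True
    \<comment> \<open>A last witness is taken: the loss of \<diamond>\<psi> makes the successor
      strict.\<close>
    have *: "(char_fm \<Gamma> X \<^bold>\<longrightarrow> \<^bold>\<not> \<^bold>\<box> \<^bold>\<not> (\<psi> \<^bold>\<and> \<^bold>\<not> \<^bold>\<diamond> \<psi>)) \<in> \<Lambda>"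
      using in_X Dia.prems dia_Loeb[OF Loeb[OF True]]
      by (intro char_fm_imp[of "\<^bold>\<diamond> \<psi>"]) auto
    have "\<exists>v. canon g \<Gamma> X {\<chi> \<in> set \<Gamma>. beval v \<chi>} \<and> beval v (\<psi> \<^bold>\<and> \<^bold>\<not> \<^bold>\<diamond> \<psi>)"
      by (rule canon_successor[OF Dia.prems(2) *]) (use in_X in auto)
    then show ?thesis using mem unfolding beval.simps by blast
  next
    case False
    have "(\<^bold>\<diamond> \<psi> \<^bold>\<longrightarrow> \<^bold>\<not> \<^bold>\<box> \<^bold>\<not> \<psi>) \<in> \<Lambda>"
      by (rule prop_consequence[of "{\<^bold>\<diamond> \<psi> \<^bold>\<longleftrightarrow> \<^bold>\<not> \<^bold>\<box> \<^bold>\<not> \<psi>}"]) (auto simp: dual)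
    then have *: "(char_fm \<Gamma> X \<^bold>\<longrightarrow> \<^bold>\<not> \<^bold>\<box> \<^bold>\<not> \<psi>) \<in> \<Lambda>"
      using in_X Dia.prems by (intro char_fm_imp[of "\<^bold>\<diamond> \<psi>"]) auto
    have "\<exists>v. canon g \<Gamma> X {\<chi> \<in> set \<Gamma>. beval v \<chi>} \<and> beval v \<psi>"
      by (rule canon_successor[OF Dia.prems(2) *]) (use False in auto)
    then show ?thesis using mem by blast
  qed
  then show ?case
    using Dia.IH[OF mem] Dia.prems unfolding sat.simps canon_def by blast
next
  case (Box \<psi>)
  have mem: "\<psi> \<in> set \<Gamma>"
    using Box.prems(1) closed subs_self by fastforce
  have "\<exists>Y. canon g \<Gamma> X Y \<and> \<psi> \<notin> Y" if notin_X: "\<^bold>\<box> \<psi> \<notin> X"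
  proof (cases g)
    case True
    \<comment> \<open>Dually, a last counterexample gains \<box>\<psi>.\<close>
    have *: "(char_fm \<Gamma> X \<^bold>\<longrightarrow> \<^bold>\<not> \<^bold>\<box> \<^bold>\<not> (\<^bold>\<not> \<psi> \<^bold>\<and> \<^bold>\<box> \<psi>)) \<in> \<Lambda>"
      using notin_X Box.prems neg_box_Loeb[OF Loeb[OF True]]
      by (intro char_fm_imp[of "\<^bold>\<box> \<psi>"]) auto
    have "\<exists>v. canon g \<Gamma> X {\<chi> \<in> set \<Gamma>. beval v \<chi>} \<and> beval v (\<^bold>\<not> \<psi> \<^bold>\<and> \<^bold>\<box> \<psi>)"
      by (rule canon_successor[OF Box.prems(2) *]) (use notin_X Box.prems(1) in auto)
    then show ?thesis unfolding beval.simps by blast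
  next
    case False
    have *: "(char_fm \<Gamma> X \<^bold>\<longrightarrow> \<^bold>\<not> \<^bold>\<box> \<^bold>\<not> \<^bold>\<not> \<psi>) \<in> \<Lambda>"
      using notin_X Box.prems neg_box by (intro char_fm_imp[of "\<^bold>\<box> \<psi>"]) auto
    have "\<exists>v. canon g \<Gamma> X {\<chi> \<in> set \<Gamma>. beval v \<chi>} \<and> beval v (\<^bold>\<not> \<psi>)"
      by (rule canon_successor[OF Box.prems(2) *]) (use False in auto)
    then show ?thesis unfolding beval.simps by blast
  qed
  then show ?case
    using Box.IH[OF mem] Box.prems unfolding sat.simps canon_def by blast
next
  case (Neg \<psi>)
  obtain v where "X = {\<chi> \<in> set \<Gamma>. beval v \<chi>}" using Neg.prems(2) by (rule world_valuation)
  moreover have "\<psi> \<in> set \<Gamma>" using Neg.prems(1) closed subs_self by fastforce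
  ultimately show ?case using Neg by auto
next
  case (And \<psi> \<chi>)
  obtain v where "X = {\<chi> \<in> set \<Gamma>. beval v \<chi>}" using And.prems(2) by (rule world_valuation)
  moreover have "\<psi> \<in> set \<Gamma>" "\<chi> \<in> set \<Gamma>" using And.prems(1) closed subs_self by fastforce+
  ultimately show ?case using And by auto
next
  case (Or \<psi> \<chi>)
  obtain v where "X = {\<chi> \<in> set \<Gamma>. beval v \<chi>}" using Or.prems(2) by (rule world_valuation)
  moreover have "\<psi> \<in> set \<Gamma>" "\<chi> \<in> set \<Gamma>" using Or.prems(1) closed subs_self by fastforce+
  ultimately show ?case using Or by auto
next
  case (Imp \<psi> \<chi>)
  obtain v where "X = {\<chi> \<in> set \<Gamma>. beval v \<chi>}" using Imp.prems(2) by (rule world_valuation)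
  moreover have "\<psi> \<in> set \<Gamma>" "\<chi> \<in> set \<Gamma>" using Imp.prems(1) closed subs_self by fastforce+
  ultimately show ?case using Imp by auto
next
  case Bot
  obtain v where "X = {\<chi> \<in> set \<Gamma>. beval v \<chi>}" using Bot.prems(2) by (rule world_valuation)
  then show ?case by auto
next
  case Top
  obtain v where "X = {\<chi> \<in> set \<Gamma>. beval v \<chi>}" using Top.prems(2) by (rule world_valuation)
  then show ?case using Top.prems(1) by auto
qed simp

end

end

lemma normal_logic: "normal_modal_logic (logic g)"
  unfolding logic_def logic_GL_def logic_K_def by (simp add: normal_least_normal_logic)

lemma logic_Loeb: "(\<^bold>\<box> (\<^bold>\<box> \<phi> \<^bold>\<longrightarrow> \<phi>) \<^bold>\<longrightarrow> \<^bold>\<box> \<phi>) \<in> logic True"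
proof -
  have "(\<^bold>\<box> (\<^bold>\<box> (Var 0) \<^bold>\<longrightarrow> Var 0) \<^bold>\<longrightarrow> \<^bold>\<box> (Var 0)) \<in> logic True"
    unfolding logic_def logic_GL_def least_normal_logic_def by auto
  then have "subst (\<lambda>_. \<phi>) (\<^bold>\<box> (\<^bold>\<box> (Var 0) \<^bold>\<longrightarrow> Var 0) \<^bold>\<longrightarrow> \<^bold>\<box> (Var 0)) \<in> logic True"
    using normal_logic unfolding normal_modal_logic_def by blast
  then show ?thesis by simp
qed

text \<open>The countermodel consists of subsets of \<open>subs \<phi>\<close>, whence the world
  type \<open>fm set\<close>. As this type is infinite, finiteness is expressed through a finite set
  \<open>W\<close> that contains \<open>w\<close> and the range of \<open>R\<close>.\<close>

lemma finite_completeness: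
  assumes "\<And>(R :: fm set \<Rightarrow> fm set \<Rightarrow> bool) V W w. okframe g R \<Longrightarrow> finite W \<Longrightarrow> w \<in> W \<Longrightarrow>
    (\<And>u v. R u v \<Longrightarrow> v \<in> W) \<Longrightarrow> sat R V w \<phi>"
  shows "\<phi> \<in> logic g"
proof (rule ccontr)
  let ?\<Gamma> = "subs \<phi>" and ?W = "worlds (logic g) (subs \<phi>)"
  assume "\<phi> \<notin> logic g"
  then obtain X where X: "X \<in> ?W" "\<phi> \<notin> X"
    using world_existence[OF normal_logic _ subs_self] by blast
  have "sat (canon (logic g) g ?\<Gamma>) (\<lambda>X x. Var x \<in> X) X \<phi> \<longleftrightarrow> \<phi> \<in> X"
    by (rule truth[OF normal_logic])
      (use logic_Loeb X in \<open>auto intro: subs_trans subs_self\<close>)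
  moreover have "sat (canon (logic g) g ?\<Gamma>) (\<lambda>X x. Var x \<in> X) X \<phi>"
    by (rule assms[OF okframe_canon[OF normal_logic] finite_worlds[OF normal_logic] X(1)])
      (simp add: canon_def[OF normal_logic])
  ultimately show False using X(2) by blast
qed

section \<open>Marking worlds\<close>

definition mark :: "('w \<Rightarrow> nat \<Rightarrow> bool) \<Rightarrow> nat \<Rightarrow> 'w set \<Rightarrow> 'w \<Rightarrow> nat \<Rightarrow> bool" where
  "mark V p A = (\<lambda>w. (V w)(p := w \<in> A))"

lemma mark_self: "mark V p {w. V w p} = V"
  unfolding mark_def by auto

lemma sat_subst_bot: "sat R V w (subst (Var(p := \<^bold>\<bottom>)) \<phi>) \<longleftrightarrow> sat R (mark V p {}) w \<phi>"
  unfolding sat_subst by (rule sat_cong) (simp add: mark_def)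

lemma vars_subst_bot: "vars (subst (Var(p := \<^bold>\<bottom>)) \<phi>) = vars \<phi> - {p}"
  by (induction \<phi>) auto

lemma sat_additive_fm:
  assumes "p \<noteq> q" "q \<notin> vars \<phi>"
  shows "sat R V w (subst (Var(p := Var p \<^bold>\<or> Var q)) \<phi> \<^bold>\<longleftrightarrow> \<phi> \<^bold>\<or> subst (Var(p := Var q)) \<phi>) \<longleftrightarrow>
    (sat R (mark V p ({u. V u p} \<union> {u. V u q})) w \<phi> \<longleftrightarrow>
     sat R (mark V p {u. V u p}) w \<phi> \<or> sat R (mark V p {u. V u q}) w \<phi>)"
proof -
  have "sat R V w (subst (Var(p := Var p \<^bold>\<or> Var q)) \<phi>) \<longleftrightarrow>
      sat R (mark V p ({u. V u p} \<union> {u. V u q})) w \<phi>"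
    and "sat R V w (subst (Var(p := Var q)) \<phi>) \<longleftrightarrow> sat R (mark V p {u. V u q}) w \<phi>"
    unfolding sat_subst by (rule sat_cong; simp add: mark_def)+
  then show ?thesis unfolding mark_self by auto
qed

text \<open>Arbitrary \<open>A\<close> and \<open>B\<close> are supplied as the extensions of
  \<open>p\<close> and \<open>q\<close> in \<open>?V\<close>; changing \<open>q\<close> does not
  affect \<phi>.\<close>

lemma additive_sat:
  assumes "additive (logic g) p q \<phi>" "p \<noteq> q" "q \<notin> vars \<phi>" "okframe g R"
  shows "sat R (mark V p (A \<union> B)) w \<phi> \<longleftrightarrow> sat R (mark V p A) w \<phi> \<or> sat R (mark V p B) w \<phi>"
proof -
  let ?V = "mark (mark V p A) q B"
  have eq: "sat R (mark ?V p C) w \<phi> = sat R (mark V p C) w \<phi>" for C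
    by (rule sat_cong) (use assms(3) in \<open>auto simp: mark_def\<close>)
  have "{u. ?V u p} = A" "{u. ?V u q} = B"
    using assms(2) unfolding mark_def by auto
  moreover have "sat R ?V w (subst (Var(p := Var p \<^bold>\<or> Var q)) \<phi> \<^bold>\<longleftrightarrow> \<phi> \<^bold>\<or> subst (Var(p := Var q)) \<phi>)"
    by (rule soundness[OF _ assms(4)]) (use assms(1) additive_def in blast)
  ultimately show ?thesis
    unfolding sat_additive_fm[OF assms(2,3)] by (simp only: eq)
qed

text \<open>Points are split off one at a time, hence the finiteness of \<open>A\<close>; this is
  where finite models pay off.\<close>

lemma additive_finite:
  assumes add: "\<And>A B. sat R (mark V p (A \<union> B)) w \<phi> \<longleftrightarrow> sat R (mark V p A) w \<phi> \<or> sat R (mark V p B) w \<phi>"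
    and "finite A"
  shows "sat R (mark V p A) w \<phi> \<Longrightarrow> sat R (mark V p {}) w \<phi> \<or> (\<exists>a\<in>A. sat R (mark V p {a}) w \<phi>)"
  using \<open>finite A\<close>
proof (induction A rule: finite_induct)
  case (insert a A)
  then show ?case using add[of "{a}" A] by auto
qed simp

section \<open>Unravelling with twins\<close>

text \<open>Worlds are paths in which every step carries a bit. Thus every world but the root has a twin:
  marking a world leaves among its siblings an unmarked copy of it.\<close>

abbreviation fst_rel :: "('w \<Rightarrow> 'w \<Rightarrow> bool) \<Rightarrow> 'w \<times> bool \<Rightarrow> 'w \<times> bool \<Rightarrow> bool" where
  "fst_rel R \<equiv> \<lambda>a b. R (fst a) (fst b)"

text \<open>For K a successor adds one step, for GL any positive number of steps, which makes the
  relation transitive. No root is fixed: the paths from all starting points form a forest.\<close>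

definition unravel ::
  "bool \<Rightarrow> ('w \<Rightarrow> 'w \<Rightarrow> bool) \<Rightarrow> ('w \<times> bool) list \<Rightarrow> ('w \<times> bool) list \<Rightarrow> bool" where
  "unravel g R x y \<longleftrightarrow> x \<noteq> [] \<and> successively (fst_rel R) y \<and>
     (\<exists>zs. y = x @ zs \<and> zs \<noteq> [] \<and> (g \<or> length zs = 1))"

abbreviation lift :: "('w \<Rightarrow> nat \<Rightarrow> bool) \<Rightarrow> ('w \<times> bool) list \<Rightarrow> nat \<Rightarrow> bool" where
  "lift V \<equiv> \<lambda>x. V (fst (last x))"

lemma unravel_last:
  assumes "okframe g R" "unravel g R x y"
  shows "R (fst (last x)) (fst (last y))"
proof -
  obtain zs where zs: "y = x @ zs" "zs \<noteq> []" "g \<or> length zs = 1" "x \<noteq> []" "successively (fst_rel R) y"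
    using assms(2) unfolding unravel_def by blast
  show ?thesis
  proof (cases "length zs = 1")
    case True
    then obtain z where "zs = [z]" by (auto simp: length_Suc_conv)
    with zs show ?thesis by (simp add: successively_append_iff)
  next
    case False
    with zs assms(1) have "transp R" unfolding okframe_def by simp
    then have "transp (fst_rel R)" unfolding transp_def by blast
    with zs have "sorted_wrt (fst_rel R) (x @ zs)" by (simp add: successively_conv_sorted_wrt)
    with zs show ?thesis by (auto simp: sorted_wrt_append)
  qed
qed

lemma unravel_step:
  assumes "x \<noteq> []" "successively (fst_rel R) x" "R (fst (last x)) u"
  shows "unravel g R x (x @ [(u, b)])"
  using assms unfolding unravel_def by (auto simp: successively_append_iff)

text \<open>Converse well-foundedness is pulled back along the endpoint map.\<close>

lemma okframe_unravel:
  assumes "okframe g R"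
  shows "okframe g (unravel g R)"
  unfolding okframe_def
proof (intro impI conjI)
  assume g
  then show "transp (unravel g R)"
    unfolding transp_def unravel_def by auto
  have "wfp (R\<inverse>\<inverse>)"
    using assms \<open>g\<close> unfolding okframe_def by blast
  then show "wfp ((unravel g R)\<inverse>\<inverse>)"
    by (rule wfp_if_convertible_to_wfp[where f = "\<lambda>x. fst (last x)"])
      (use unravel_last[OF assms] in auto)
qed

text \<open>The endpoint map is a bounded morphism. The successor-closed set \<open>C\<close> lets
  the lemma apply also when \<open>U\<close> deviates from the lifted valuation outside
  \<open>C\<close>, as it does at a marked path.\<close>

lemma sat_unravel:
  assumes ok: "okframe g R"
    and C: "\<And>x. x \<in> C \<Longrightarrow> x \<noteq> [] \<and> successively (fst_rel R) x \<and> U x = V (fst (last x))"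
    and closed: "\<And>x y. x \<in> C \<Longrightarrow> unravel g R x y \<Longrightarrow> y \<in> C"
  shows "x \<in> C \<Longrightarrow> sat (unravel g R) U x \<phi> = sat R V (fst (last x)) \<phi>"
proof (induction \<phi> arbitrary: x)
  case (Var v)
  then show ?case using C by simp
next
  case (Dia \<phi>)
  have "\<exists>y. unravel g R x y \<and> fst (last y) = u" if "R (fst (last x)) u" for u
    using unravel_step[of x R u g True] C[OF Dia.prems] that by fastforce
  then show ?case
    using Dia unravel_last[OF ok] closed unfolding sat.simps by metis
next
  case (Box \<phi>)
  have "\<exists>y. unravel g R x y \<and> fst (last y) = u" if "R (fst (last x)) u" for u
    using unravel_step[of x R u g True] C[OF Box.prems] that by fastforce
  then show ?case
    using Box unravel_last[OF ok] closed unfolding sat.simps by metis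
qed simp_all

section \<open>Locality and finiteness of the relevant part of the unravelling\<close>

primrec depth :: "fm \<Rightarrow> nat" where
  "depth (Var x) = 0"
| "depth \<^bold>\<bottom> = 0"
| "depth \<^bold>\<top> = 0"
| "depth (\<^bold>\<not> \<phi>) = depth \<phi>"
| "depth (\<phi> \<^bold>\<and> \<psi>) = max (depth \<phi>) (depth \<psi>)"
| "depth (\<phi> \<^bold>\<or> \<psi>) = max (depth \<phi>) (depth \<psi>)"
| "depth (\<phi> \<^bold>\<longrightarrow> \<psi>) = max (depth \<phi>) (depth \<psi>)"
| "depth (\<^bold>\<diamond> \<phi>) = Suc (depth \<phi>)"
| "depth (\<^bold>\<box> \<phi>) = Suc (depth \<phi>)"

text \<open>The worlds that can matter at the root \<open>[r]\<close>. Only K needs a length bound;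
  for GL converse well-foundedness keeps the set finite over a finite frame.\<close>

definition reach ::
  "bool \<Rightarrow> ('w \<Rightarrow> 'w \<Rightarrow> bool) \<Rightarrow> 'w \<times> bool \<Rightarrow> nat \<Rightarrow> ('w \<times> bool) list set" where
  "reach g R r N = {x. x \<noteq> [] \<and> hd x = r \<and> successively (fst_rel R) x \<and> (\<not> g \<longrightarrow> length x \<le> N)}"

text \<open>For K evaluation looks ahead by at most the modal depth and so stays within the bound
  \<open>N\<close>; for GL \<open>reach\<close> is closed under successors.\<close>

lemma sat_unravel_local:
  assumes agree: "\<And>y. y \<in> reach g R r N \<Longrightarrow> U y = U' y"
  shows "x \<in> reach g R r N \<Longrightarrow> (\<not> g \<longrightarrow> length x + depth \<phi> \<le> N) \<Longrightarrow>
    sat (unravel g R) U x \<phi> = sat (unravel g R) U' x \<phi>"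
proof (induction \<phi> arbitrary: x)
  case (Var v)
  then show ?case using agree by simp
next
  case (Dia \<phi>)
  have "sat (unravel g R) U y \<phi> = sat (unravel g R) U' y \<phi>" if "unravel g R x y" for y
    by (rule Dia.IH) (use that Dia.prems in \<open>auto simp: unravel_def reach_def\<close>)
  then show ?case by auto
next
  case (Box \<phi>)
  have "sat (unravel g R) U y \<phi> = sat (unravel g R) U' y \<phi>" if "unravel g R x y" for y
    by (rule Box.IH) (use that Box.prems in \<open>auto simp: unravel_def reach_def\<close>)
  then show ?case by auto
qed (simp_all add: nat_add_max_right)

text \<open>For GL a path is a chain of a transitive irreflexive relation, so it visits each world
  of \<open>W\<close> at most once.\<close>

lemma finite_reach:
  assumes ok: "okframe g R" and "finite W" and r: "fst r \<in> W"
    and closed: "\<And>u v. R u v \<Longrightarrow> v \<in> W"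
  shows "finite (reach g R r N)"
proof -
  have "set (map fst x) \<subseteq> W \<and> length x \<le> max N (card W)" if x: "x \<in> reach g R r N" for x
  proof
    have "fst (hd x) \<in> W" "successively (fst_rel R) x"
      using x r unfolding reach_def by auto
    then show W: "set (map fst x) \<subseteq> W"
      by (induction "fst_rel R" x rule: successively.induct) (auto dest: closed)
    show "length x \<le> max N (card W)"
    proof (cases g)
      case True
      then have tr: "transp R" and wf: "wfp (R\<inverse>\<inverse>)"
        using ok unfolding okframe_def by auto
      have irrefl: "\<not> R u u" for u
        using wf by (induction u rule: wfp_induct_rule) auto
      have "successively R (map fst x)"
        using x unfolding reach_def successively_map by blast
      then have "sorted_wrt R (map fst x)"
        using tr by (simp add: successively_conv_sorted_wrt)
      moreover have "sorted_wrt R us \<Longrightarrow> distinct us" for us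
        by (induction us) (auto simp: irrefl)
      ultimately have "distinct (map fst x)" by blast
      then have "length (map fst x) = card (set (map fst x))"
        by (rule distinct_card[symmetric])
      also have "\<dots> \<le> card W"
        using W \<open>finite W\<close> by (rule card_mono[rotated])
      finally show ?thesis by simp
    qed (use x in \<open>auto simp: reach_def\<close>)
  qed
  then have "reach g R r N \<subseteq> {x. set x \<subseteq> W \<times> UNIV \<and> length x \<le> max N (card W)}"
    by fastforce
  then show ?thesis
    by (rule finite_subset) (intro finite_lists_length_le finite_SigmaI \<open>finite W\<close> finite)
qed


section \<open>Truth along a marked path\<close>

text \<open>\<open>path_sat g p l \<phi>\<close> computes the truth of \<open>\<phi>\<close> in an unravelling in which \<open>p\<close> holds at a single
  world. The list \<open>l\<close> records, along the path leading to that world, which subformulas would hold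
  if \<open>p\<close> held nowhere. The value at a box is junk: boxes are eliminated beforehand.\<close>

primrec path_sat :: "bool \<Rightarrow> nat \<Rightarrow> fm set list \<Rightarrow> fm \<Rightarrow> bool" where
  "path_sat g p l (Var x) \<longleftrightarrow> (if x = p then length l = 1 else Var x \<in> hd l)"
| "path_sat g p l \<^bold>\<bottom> \<longleftrightarrow> False"
| "path_sat g p l \<^bold>\<top> \<longleftrightarrow> True"
| "path_sat g p l (\<^bold>\<not> \<phi>) \<longleftrightarrow> \<not> path_sat g p l \<phi>"
| "path_sat g p l (\<phi> \<^bold>\<and> \<psi>) \<longleftrightarrow> path_sat g p l \<phi> \<and> path_sat g p l \<psi>"
| "path_sat g p l (\<phi> \<^bold>\<or> \<psi>) \<longleftrightarrow> path_sat g p l \<phi> \<or> path_sat g p l \<psi>"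
| "path_sat g p l (\<phi> \<^bold>\<longrightarrow> \<psi>) \<longleftrightarrow> (path_sat g p l \<phi> \<longrightarrow> path_sat g p l \<psi>)"
| "path_sat g p l (\<^bold>\<diamond> \<phi>) \<longleftrightarrow> \<^bold>\<diamond> \<phi> \<in> hd l \<or>
     (\<exists>n. 0 < n \<and> n < length l \<and> (g \<or> n = 1) \<and> path_sat g p (drop n l) \<phi>)"
| "path_sat g p l (\<^bold>\<box> \<phi>) \<longleftrightarrow> False"

primrec unbox :: "fm \<Rightarrow> fm" where
  "unbox (Var x) = Var x"
| "unbox \<^bold>\<bottom> = \<^bold>\<bottom>"
| "unbox \<^bold>\<top> = \<^bold>\<top>"
| "unbox (\<^bold>\<not> \<phi>) = \<^bold>\<not> unbox \<phi>"
| "unbox (\<phi> \<^bold>\<and> \<psi>) = unbox \<phi> \<^bold>\<and> unbox \<psi>"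
| "unbox (\<phi> \<^bold>\<or> \<psi>) = unbox \<phi> \<^bold>\<or> unbox \<psi>"
| "unbox (\<phi> \<^bold>\<longrightarrow> \<psi>) = (unbox \<phi> \<^bold>\<longrightarrow> unbox \<psi>)"
| "unbox (\<^bold>\<diamond> \<phi>) = \<^bold>\<diamond> unbox \<phi>"
| "unbox (\<^bold>\<box> \<phi>) = \<^bold>\<not> \<^bold>\<diamond> \<^bold>\<not> unbox \<phi>"

lemma sat_unbox: "sat R V w (unbox \<phi>) = sat R V w \<phi>"
  by (induction \<phi> arbitrary: w) auto

lemma vars_unbox: "vars (unbox \<phi>) = vars \<phi>"
  by (induction \<phi>) auto

lemma box_notin_subs_unbox: "\<^bold>\<box> \<psi> \<notin> set (subs (unbox \<phi>))"
  by (induction \<phi>) auto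

text \<open>The type is taken with no world marked, because this is how the unravelling behaves away
  from the marked path.\<close>

definition tp :: "('w \<Rightarrow> 'w \<Rightarrow> bool) \<Rightarrow> ('w \<Rightarrow> nat \<Rightarrow> bool) \<Rightarrow> fm \<Rightarrow> nat \<Rightarrow> 'w \<Rightarrow> fm set" where
  "tp R V \<phi> p u = {\<chi> \<in> set (subs \<phi>). sat R (mark V p {}) u \<chi>}"

text \<open>A successor of a prefix of \<open>a\<close> either is a longer prefix, where the
  induction hypothesis applies, or has left \<open>a\<close> for good and sees no mark. These are
  the two disjuncts in the diamond clause of \<open>path_sat\<close>; twins ensure that every
  \<open>R\<close>-successor is also realised off the path.\<close>

lemma sat_marked_path:
  assumes ok: "okframe g R" and a: "successively (fst_rel R) a"
    and nobox: "\<And>\<chi>. \<^bold>\<box> \<chi> \<notin> set (subs \<phi>)"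
  shows "\<psi> \<in> set (subs \<phi>) \<Longrightarrow> i < length a \<Longrightarrow>
    sat (unravel g R) (mark (lift V) p {a}) (take (Suc i) a) \<psi> \<longleftrightarrow>
    path_sat g p (map (\<lambda>b. tp R V \<phi> p (fst b)) (drop i a)) \<psi>"
proof (induction \<psi> arbitrary: i)
  case (Var v)
  \<comment> \<open>The mark sits at \<open>a\<close> itself, reached exactly when one entry
    remains; hence the test \<open>length l = 1\<close> in \<open>path_sat\<close>.\<close>
  have "take (Suc i) a = a \<longleftrightarrow> length a - i = 1"
    using Var.prems(2) by auto
  moreover have "last (take (Suc i) a) = a ! i" "hd (drop i a) = a ! i"
    using Var.prems(2) by (simp_all add: take_Suc_conv_app_nth hd_drop_conv_nth)
  ultimately show ?case
    using Var.prems by (auto simp: mark_def tp_def hd_map)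
next
  case (Dia \<psi>)
  let ?x = "take (Suc i) a" and ?T = "unravel g R" and ?U = "mark (lift V) p {a}"
  have \<psi>: "\<psi> \<in> set (subs \<phi>)"
    using Dia.prems(1) by (rule subs_closed)
  have last_x: "last ?x = a ! i" and "?x \<noteq> []"
    using Dia.prems(2) by (simp_all add: take_Suc_conv_app_nth)
  have take_path: "successively (fst_rel R) (take n a)" for n
    using a by (metis append_take_drop_id successively_append_iff)
  have hd_map_drop: "hd (map (\<lambda>b. tp R V \<phi> p (fst b)) (drop i a)) = tp R V \<phi> p (fst (a ! i))"
    using Dia.prems(2) by (simp add: hd_map hd_drop_conv_nth)
  have marked: "sat ?T ?U (take (Suc (i + n)) a) \<psi> \<longleftrightarrow>
      path_sat g p (drop n (map (\<lambda>b. tp R V \<phi> p (fst b)) (drop i a))) \<psi>" if "i + n < length a" for n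
    using Dia.IH[OF \<psi> that] by (simp add: drop_map add.commute)
  \<comment> \<open>The paths that are not prefixes of \<open>a\<close>. Their extensions are not
    prefixes either, so the mark never affects them.\<close>
  let ?C = "{y. y \<noteq> [] \<and> successively (fst_rel R) y \<and> take (length y) a \<noteq> y}"
  have unmarked: "sat ?T ?U y \<psi> \<longleftrightarrow> sat R (mark V p {}) (fst (last y)) \<psi>" if "y \<in> ?C" for y
  proof (rule sat_unravel[OF ok _ _ that])
    show "z \<in> ?C" if "y \<in> ?C" "?T y z" for y z
    proof -
      from that obtain zs where z: "z = y @ zs" "successively (fst_rel R) z"
        unfolding unravel_def by blast
      have "take (length z) a \<noteq> z"
      proof
        assume "take (length z) a = z"
        then have "take (length y) (take (length z) a) = y" by (simp add: z(1))
        then have "take (length y) a = y" by (simp add: z(1))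
        with that(1) show False by simp
      qed
      with z that(1) show ?thesis by simp
    qed
  qed (auto simp: mark_def fun_eq_iff)
  show ?case
  proof
    assume "sat ?T ?U ?x (\<^bold>\<diamond> \<psi>)"
    then obtain y where y: "?T ?x y" "sat ?T ?U y \<psi>" by auto
    then obtain zs where zs: "y = ?x @ zs" "zs \<noteq> []" "g \<or> length zs = 1"
      and path: "successively (fst_rel R) y"
      unfolding unravel_def by blast
    show "path_sat g p (map (\<lambda>b. tp R V \<phi> p (fst b)) (drop i a)) (\<^bold>\<diamond> \<psi>)"
    proof (cases "y \<in> ?C")
      case True
      have "R (fst (a ! i)) (fst (last y))"
        using unravel_last[OF ok y(1)] last_x by simp
      with True y(2) unmarked have "sat R (mark V p {}) (fst (a ! i)) (\<^bold>\<diamond> \<psi>)" by auto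
      with Dia.prems(1) show ?thesis by (simp only: path_sat.simps hd_map_drop) (simp add: tp_def)
    next
      case False
      have len: "length y = Suc (i + length zs)" using zs(1) Dia.prems(2) by simp
      have "take (length y) a = y" using False zs path by auto
      then have prefix: "take (Suc (i + length zs)) a = y" and "length y \<le> length a"
        using len by (metis, metis length_take min.cobounded1)
      then have "i + length zs < length a" using len by simp
      with marked[of "length zs"] y(2) prefix zs(2,3) show ?thesis by auto
    qed
  next
    assume "path_sat g p (map (\<lambda>b. tp R V \<phi> p (fst b)) (drop i a)) (\<^bold>\<diamond> \<psi>)"
    then have "\<^bold>\<diamond> \<psi> \<in> tp R V \<phi> p (fst (a ! i)) \<or> (\<exists>n. 0 < n \<and> n < length a - i \<and> (g \<or> n = 1) \<and>
        path_sat g p (drop n (map (\<lambda>b. tp R V \<phi> p (fst b)) (drop i a))) \<psi>)"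
      by (simp only: path_sat.simps hd_map_drop length_map length_drop)
    then show "sat ?T ?U ?x (\<^bold>\<diamond> \<psi>)"
    proof (rule disjE)
      assume "\<^bold>\<diamond> \<psi> \<in> tp R V \<phi> p (fst (a ! i))"
      then obtain u where u: "R (fst (a ! i)) u" "sat R (mark V p {}) u \<psi>"
        unfolding tp_def by auto
      \<comment> \<open>The flipped bit makes \<open>?y\<close> leave \<open>a\<close> even if
        \<open>u\<close> is the next world on it. At the end of \<open>a\<close> the index is out of
        range, but then \<open>?y\<close> is too long to be a prefix.\<close>
      let ?y = "?x @ [(u, \<not> snd (a ! Suc i))]"
      have y: "?T ?x ?y"
        using unravel_step \<open>?x \<noteq> []\<close> take_path u(1) last_x by metis
      have "take (length ?y) a \<noteq> ?y"
      proof (cases "Suc i < length a")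
        case True
        then have "take (length ?y) a = ?x @ [a ! Suc i]"
          by (simp add: take_Suc_conv_app_nth min_def)
        then show ?thesis by (metis last_snoc snd_conv)
      next
        case False
        then have "length (take (length ?y) a) \<noteq> length ?y" using Dia.prems(2) by simp
        then show ?thesis by metis
      qed
      with y have "?y \<in> ?C" unfolding unravel_def by blast
      with unmarked u(2) have "sat ?T ?U ?y \<psi>" by simp
      with y show ?thesis by auto
    next
      assume "\<exists>n. 0 < n \<and> n < length a - i \<and> (g \<or> n = 1) \<and>
        path_sat g p (drop n (map (\<lambda>b. tp R V \<phi> p (fst b)) (drop i a))) \<psi>"
      then obtain n where n: "0 < n" "n < length a - i" "g \<or> n = 1"
        "path_sat g p (drop n (map (\<lambda>b. tp R V \<phi> p (fst b)) (drop i a))) \<psi>"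
        by (elim exE conjE) (rule that)
      then have less: "i + n < length a" by simp
      let ?y = "take (Suc (i + n)) a"
      have "?y = ?x @ take n (drop (Suc i) a)"
        by (metis add_Suc take_add)
      moreover have "take n (drop (Suc i) a) \<noteq> []" "g \<or> length (take n (drop (Suc i) a)) = 1"
        using n less by auto
      ultimately have "?T ?x ?y"
        unfolding unravel_def using take_path \<open>?x \<noteq> []\<close> by blast
      moreover have "sat ?T ?U ?y \<psi>"
        using marked[OF less] n(4) by blast
      ultimately show ?thesis by auto
    qed
  qed
next
  case (Box \<psi>)
  with nobox show ?case by blast
next
  case (Neg \<psi>)
  then show ?case using subs_closed(1)[OF Neg.prems(1)] by simp
next
  case (And \<psi> \<chi>)
  then show ?case using subs_closed(2)[OF And.prems(1)] by simp
next
  case (Or \<psi> \<chi>)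
  then show ?case using subs_closed(3)[OF Or.prems(1)] by simp
next
  case (Imp \<psi> \<chi>)
  then show ?case using subs_closed(4)[OF Imp.prems(1)] by simp
qed simp_all

section \<open>Characteristic delta-formulas\<close>

text \<open>Putting \<bottom> for \<open>p\<close> turns the state descriptions into parameter
  formulas and makes them describe exactly the types \<open>tp\<close>.\<close>

definition delta_of :: "fm \<Rightarrow> nat \<Rightarrow> fm set list \<Rightarrow> fm" where
  "delta_of \<phi> p l = (let \<kappa> = \<lambda>s. subst (Var(p := \<^bold>\<bottom>)) (char_fm (subs \<phi>) s)
    in delta p (\<kappa> (hd l)) (map \<kappa> (tl l)))"

lemma vars_subs: "\<chi> \<in> set (subs \<phi>) \<Longrightarrow> vars \<chi> \<subseteq> vars \<phi>"
  by (induction \<phi>) auto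

lemma vars_char_fm: "vars (char_fm \<phi>s X) = (\<Union>\<chi>\<in>set \<phi>s. vars \<chi>)"
  by (induction \<phi>s) (auto simp: char_fm_def)

lemma delta_of_in_Delta:
  assumes "vars \<phi> \<subseteq> insert p R"
  shows "delta_of \<phi> p l \<in> Delta p R"
proof -
  have *: "subst (Var(p := \<^bold>\<bottom>)) (char_fm (subs \<phi>) s) \<in> Fm R" for s
    using vars_subs assms unfolding Fm_def vars_subst_bot vars_char_fm mem_Collect_eq by blast
  show ?thesis
    unfolding delta_of_def Delta_def Let_def
    by (intro CollectI exI conjI, rule refl) (use * in auto)
qed

lemma sat_char_tp:
  "s \<subseteq> set (subs \<phi>) \<Longrightarrow>
    sat R V w (subst (Var(p := \<^bold>\<bottom>)) (char_fm (subs \<phi>) s)) \<longleftrightarrow> tp R V \<phi> p w = s"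
  unfolding sat_subst_bot sat_char_fm tp_def by auto

text \<open>By induction on \<open>l\<close>: each diamond picks the next world of \<open>b\<close>,
  and the innermost conjunct \<open>Var p\<close> yields the condition on the last one.\<close>

lemma sat_delta_of:
  "l \<noteq> [] \<Longrightarrow> set l \<subseteq> Pow (set (subs \<phi>)) \<Longrightarrow> sat R V w (delta_of \<phi> p l) \<longleftrightarrow>
    (\<exists>b. b \<noteq> [] \<and> hd b = w \<and> successively R b \<and> map (tp R V \<phi> p) b = l \<and> V (last b) p)"
proof (induction l arbitrary: w rule: list_nonempty_induct)
  case (single s)
  then have "sat R V w (delta_of \<phi> p [s]) \<longleftrightarrow> tp R V \<phi> p w = s \<and> V w p"
    using sat_char_tp[of s \<phi> R V w p] by (simp add: delta_of_def)
  moreover have "(\<exists>b. b \<noteq> [] \<and> hd b = w \<and> successively R b \<and> map (tp R V \<phi> p) b = [s] \<and> V (last b) p) \<longleftrightarrow>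
      tp R V \<phi> p w = s \<and> V w p"
    by (auto simp: map_eq_Cons_conv intro!: exI[of _ "[w]"])
  ultimately show ?case by simp
next
  case (cons s l)
  then have "delta_of \<phi> p (s # l) =
      subst (Var(p := \<^bold>\<bottom>)) (char_fm (subs \<phi>) s) \<^bold>\<and> \<^bold>\<diamond> delta_of \<phi> p l"
    by (cases l) (simp_all add: delta_of_def)
  then have "sat R V w (delta_of \<phi> p (s # l)) \<longleftrightarrow>
      tp R V \<phi> p w = s \<and> (\<exists>u. R w u \<and> sat R V u (delta_of \<phi> p l))"
    using sat_char_tp[of s \<phi> R V w p] cons.prems by simp
  also have "\<dots> \<longleftrightarrow> tp R V \<phi> p w = s \<and> (\<exists>u. R w u \<and>
      (\<exists>b. b \<noteq> [] \<and> hd b = u \<and> successively R b \<and> map (tp R V \<phi> p) b = l \<and> V (last b) p))"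
    using cons.IH cons.prems by simp
  also have "\<dots> \<longleftrightarrow> (\<exists>b. b \<noteq> [] \<and> hd b = w \<and> successively R b \<and>
      map (tp R V \<phi> p) b = s # l \<and> V (last b) p)" (is "?A \<longleftrightarrow> ?B")
  proof
    assume ?A
    then obtain b where b: "tp R V \<phi> p w = s" "b \<noteq> []" "R w (hd b)" "successively R b"
      "map (tp R V \<phi> p) b = l" "V (last b) p" by blast
    then show ?B by (intro exI[of _ "w # b"]) (simp add: successively_Cons)
  next
    assume ?B
    then obtain b where b: "b \<noteq> []" "hd b = w" "successively R b"
      "map (tp R V \<phi> p) b = s # l" "V (last b) p"
      by (elim exE conjE) (rule that)
    then obtain b' where b': "b = w # b'" by (cases b) auto
    with b(4) \<open>l \<noteq> []\<close> have "tp R V \<phi> p w = s" "map (tp R V \<phi> p) b' = l" "b' \<noteq> []"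
      by auto
    moreover from this b(3,5) have "R w (hd b')" "successively R b'" "V (last b') p"
      unfolding b' by (simp_all add: successively_Cons)
    ultimately show ?A by blast
  qed
  finally show ?case .
qed

lemma sat_Disj: "sat R V w (Disj \<phi>s) \<longleftrightarrow> (\<exists>\<phi>\<in>set \<phi>s. sat R V w \<phi>)"
  unfolding Disj_def by (induction \<phi>s) auto

lemma sat_unravel_root:
  assumes "okframe g R"
  shows "sat (unravel g R) (lift V) [(w, b)] \<phi> \<longleftrightarrow> sat R V w \<phi>"
proof -
  have "sat (unravel g R) (lift V) [(w, b)] \<phi> \<longleftrightarrow> sat R V (fst (last [(w, b)])) \<phi>"
    by (rule sat_unravel[OF assms, of "{x. x \<noteq> [] \<and> successively (fst_rel R) x}"])
      (auto simp: unravel_def)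
  then show ?thesis by simp
qed

text \<open>A path described by the \<delta>-formula is lifted to the unravelling. With only its end
  marked, \<phi> holds at the root; by additivity it still holds once all other worlds satisfying
  \<open>p\<close> are marked, and this is the lifted model.\<close>

lemma sat_delta_of_imp:
  fixes R :: "'w \<Rightarrow> 'w \<Rightarrow> bool"
  assumes ok: "okframe g R" and nobox: "\<And>\<chi>. \<^bold>\<box> \<chi> \<notin> set (subs \<phi>)"
    and add: "\<And>V A B x. sat (unravel g R) (mark V p (A \<union> B)) x \<phi> \<longleftrightarrow>
      sat (unravel g R) (mark V p A) x \<phi> \<or> sat (unravel g R) (mark V p B) x \<phi>"
    and l: "l \<noteq> []" "set l \<subseteq> Pow (set (subs \<phi>))" "path_sat g p l \<phi>"
    and delta: "sat R V w (delta_of \<phi> p l)"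
  shows "sat R V w \<phi>"
proof -
  obtain b where b: "b \<noteq> []" "hd b = w" "successively R b" "map (tp R V \<phi> p) b = l" "V (last b) p"
    using sat_delta_of[OF l(1,2), THEN iffD1, OF delta] by (elim exE conjE) (rule that)
  define a where "a = map (\<lambda>u. (u, True)) b"
  have a: "a \<noteq> []" "successively (fst_rel R) a" "map (\<lambda>u. tp R V \<phi> p (fst u)) a = l"
      "take (Suc 0) a = [(w, True)]" "fst (last a) = last b"
    using b unfolding a_def by (auto simp: successively_map comp_def last_map take_Suc hd_map)
  have "sat (unravel g R) (mark (lift V) p {a}) [(w, True)] \<phi>"
    using sat_marked_path[OF ok a(2) nobox subs_self, of 0 V p] a l(3) by simp
  \<comment> \<open>The end of \<open>b\<close> satisfies \<open>p\<close>, so the mark is absorbed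
    by the extension of \<open>p\<close>.\<close>
  moreover have "{a} \<union> {x. lift V x p} = {x. lift V x p}"
    using a(5) b(5) by auto
  ultimately have "sat (unravel g R) (mark (lift V) p {x. lift V x p}) [(w, True)] \<phi>"
    using add by metis
  moreover have "mark (lift V) p {x. lift V x p} = lift V"
    by (rule mark_self)
  ultimately show ?thesis
    using sat_unravel_root[OF ok] by metis
qed

text \<open>Only finitely many worlds of the unravelling matter at the root, so the extension of
  \<open>p\<close> can be cut down to a finite set and then, by additivity, to a single path; the
  empty extension is excluded by assumption.\<close>

lemma sat_imp_marked_path:
  fixes R :: "'w \<Rightarrow> 'w \<Rightarrow> bool"
  assumes ok: "okframe g R" and nobox: "\<And>\<chi>. \<^bold>\<box> \<chi> \<notin> set (subs \<phi>)"
    and add: "\<And>V A B x. sat (unravel g R) (mark V p (A \<union> B)) x \<phi> \<longleftrightarrow>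
      sat (unravel g R) (mark V p A) x \<phi> \<or> sat (unravel g R) (mark V p B) x \<phi>"
    and W: "finite W" "w \<in> W" "\<And>u v. R u v \<Longrightarrow> v \<in> W"
    and sat: "sat R V w \<phi>" "\<not> sat R (mark V p {}) w \<phi>"
  obtains b where "b \<noteq> []" "hd b = w" "successively R b" "V (last b) p"
    "path_sat g p (map (tp R V \<phi> p) b) \<phi>" "\<not> g \<longrightarrow> length b \<le> Suc (depth \<phi>)"
proof -
  \<comment> \<open>The root is a path of length one, so \<open>Suc (depth \<phi>)\<close> covers
    everything within the modal depth.\<close>
  let ?r = "(w, True)" and ?T = "unravel g R" and ?N = "Suc (depth \<phi>)"
  let ?P = "{x \<in> reach g R ?r ?N. V (fst (last x)) p}"
  have root: "sat ?T (\<lambda>x. V' (fst (last x))) [?r] \<phi> \<longleftrightarrow> sat R V' w \<phi>" for V'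
    by (rule sat_unravel_root[OF ok])
  have "finite ?P"
    using finite_reach[OF ok W(1) _ W(3), where r = ?r and N = ?N] W(2) by simp
  moreover have "sat ?T (mark (lift V) p ?P) [?r] \<phi> \<longleftrightarrow> sat ?T (lift V) [?r] \<phi>"
  proof (rule sat_unravel_local)
    show "mark (lift V) p ?P y = lift V y" if "y \<in> reach g R ?r ?N" for y
      using that unfolding mark_def by auto
  qed (auto simp: reach_def)
  then have "sat ?T (mark (lift V) p ?P) [?r] \<phi>"
    using sat(1) root by blast
  moreover have "mark (lift V) p {} = (\<lambda>x. mark V p {} (fst (last x)))"
    unfolding mark_def by simp
  then have "\<not> sat ?T (mark (lift V) p {}) [?r] \<phi>"
    using sat(2) root by metis
  ultimately obtain a where a: "a \<in> ?P" "sat ?T (mark (lift V) p {a}) [?r] \<phi>"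
    using additive_finite[OF add] by blast
  then have path: "a \<noteq> []" "hd a = ?r" "successively (fst_rel R) a" "\<not> g \<longrightarrow> length a \<le> ?N"
    unfolding reach_def by auto
  then have "take (Suc 0) a = [?r]"
    by (cases a) auto
  then have "path_sat g p (map (\<lambda>b. tp R V \<phi> p (fst b)) a) \<phi>"
    using sat_marked_path[OF ok path(3) nobox subs_self, of 0 V p] a(2) path(1) by simp
  with path a(1) show thesis
    by (intro that[of "map fst a"]) (auto simp: successively_map hd_map last_map comp_def)
qed

section \<open>Pumping in transitive frames\<close>

text \<open>The critical case is a diamond evaluated before \<open>i\<close> whose witness lies in
  the removed segment. It then holds at \<open>i\<close>, hence at \<open>j\<close>: either a later
  witness survives, or the diamond is in the type at \<open>j\<close> and, by \<open>dia\<close>, in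
  the type at the point of evaluation.\<close>

lemma path_sat_cut:
  assumes ij: "0 < i" "i < j" "j < length l"
    and same: "\<And>\<psi>. \<psi> \<in> set (subs \<phi>) \<Longrightarrow> path_sat True p (drop i l) \<psi> = path_sat True p (drop j l) \<psi>"
    and dia: "\<And>k m \<psi>. k \<le> m \<Longrightarrow> m < length l \<Longrightarrow> \<^bold>\<diamond> \<psi> \<in> l ! m \<Longrightarrow> \<^bold>\<diamond> \<psi> \<in> l ! k"
  shows "\<psi> \<in> set (subs \<phi>) \<Longrightarrow> k \<le> i \<Longrightarrow>
    path_sat True p (drop k (take i l @ drop j l)) \<psi> = path_sat True p (drop k l) \<psi>"
proof (induction \<psi> arbitrary: k)
  case (Var x)
  show ?case
  proof (cases "k = i")
    case True
    then show ?thesis using same[OF Var.prems(1)] ij by simp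
  next
    case False
    then have "k < i" using Var.prems(2) by simp
    then have "hd (drop k (take i l @ drop j l)) = l ! k" "hd (drop k l) = l ! k"
      using ij by (simp_all add: hd_drop_conv_nth nth_append)
    moreover have "length (drop k (take i l @ drop j l)) \<noteq> 1" "length (drop k l) \<noteq> 1"
      using \<open>k < i\<close> ij by auto
    ultimately show ?thesis by simp
  qed
next
  case (Dia \<psi>)
  have \<psi>: "\<psi> \<in> set (subs \<phi>)"
    using Dia.prems(1) by (rule subs_closed)
  show ?case
  proof (cases "k = i")
    case True
    then show ?thesis using same[OF Dia.prems(1)] ij by simp
  next
    case False
    then have k: "k < i" using Dia.prems(2) by simp
    let ?l' = "take i l @ drop j l"
    \<comment> \<open>The diamond clause with absolute positions in the list instead of
      offsets.\<close>
    have path_sat_dia: "path_sat True p (drop k xs) (\<^bold>\<diamond> \<psi>) \<longleftrightarrow>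
        \<^bold>\<diamond> \<psi> \<in> xs ! k \<or> (\<exists>m. k < m \<and> m < length xs \<and> path_sat True p (drop m xs) \<psi>)"
      if "k < length xs" for k and xs :: "fm set list"
    proof -
      have "(\<exists>n. 0 < n \<and> n < length xs - k \<and> path_sat True p (drop (n + k) xs) \<psi>) \<longleftrightarrow>
          (\<exists>m. k < m \<and> m < length xs \<and> path_sat True p (drop m xs) \<psi>)" (is "?A \<longleftrightarrow> ?B")
      proof
        assume ?A
        then obtain n where "0 < n" "n < length xs - k" "path_sat True p (drop (n + k) xs) \<psi>" by blast
        then show ?B by (intro exI[of _ "n + k"]) auto
      next
        assume ?B
        then obtain m where "k < m" "m < length xs" "path_sat True p (drop m xs) \<psi>" by blast
        then show ?A by (intro exI[of _ "m - k"]) auto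
      qed
      with that show ?thesis by (simp add: hd_drop_conv_nth)
    qed
    have len: "length ?l' = i + (length l - j)" using ij by simp
    have tail: "drop m ?l' = drop (m - i + j) l" if "i \<le> m" for m
      using that ij by simp
    have "(\<exists>m. k < m \<and> m < length ?l' \<and> path_sat True p (drop m ?l') \<psi>) \<or> \<^bold>\<diamond> \<psi> \<in> l ! k \<longleftrightarrow>
        (\<exists>m. k < m \<and> m < length l \<and> path_sat True p (drop m l) \<psi>) \<or> \<^bold>\<diamond> \<psi> \<in> l ! k" (is "?A \<longleftrightarrow> ?B")
    proof
      assume ?A
      then show ?B
      proof
        assume "\<exists>m. k < m \<and> m < length ?l' \<and> path_sat True p (drop m ?l') \<psi>"
        then obtain m where m: "k < m" "m < length ?l'" "path_sat True p (drop m ?l') \<psi>" by blast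
        show ?B
        proof (cases "m \<le> i")
          case True
          with m Dia.IH[OF \<psi>, of m] ij show ?thesis by (meson le_less_trans less_trans)
        next
          case False
          then have "path_sat True p (drop (m - i + j) l) \<psi>" using m(3) tail by simp
          moreover have "k < m - i + j" "m - i + j < length l" using m(2) len k ij False by linarith+
          ultimately show ?thesis by blast
        qed
      qed blast
    next
      \<comment> \<open>Positions from \<open>j\<close> on move down by \<open>j - i\<close> in the
        shortened list.\<close>
      have late: ?A if "j \<le> m" "m < length l" "path_sat True p (drop m l) \<psi>" for m
      proof -
        have "path_sat True p (drop (m - j + i) ?l') \<psi>"
          using that tail[of "m - j + i"] by simp
        moreover have "k < m - j + i" "m - j + i < length ?l'" using that len k ij by linarith+
        ultimately show ?thesis by blast
      qed
      assume ?B
      then show ?A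
      proof
        assume "\<exists>m. k < m \<and> m < length l \<and> path_sat True p (drop m l) \<psi>"
        then obtain m where m: "k < m" "m < length l" "path_sat True p (drop m l) \<psi>" by blast
        consider "m \<le> i" | "i < m" "m < j" | "j \<le> m" by linarith
        then show ?A
        proof cases
          case 1
          then have "m < length ?l'" using len ij by linarith
          with 1 m Dia.IH[OF \<psi>, of m] show ?thesis by blast
        next
          case 2
          then have "path_sat True p (drop i l) (\<^bold>\<diamond> \<psi>)"
            using m path_sat_dia[of i l] by auto
          then have "path_sat True p (drop j l) (\<^bold>\<diamond> \<psi>)"
            using same[OF Dia.prems(1)] by simp
          then have "\<^bold>\<diamond> \<psi> \<in> l ! j \<or> (\<exists>m. j < m \<and> m < length l \<and> path_sat True p (drop m l) \<psi>)"
            using path_sat_dia[OF ij(3)] by simp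
          then show ?thesis
          proof
            assume "\<^bold>\<diamond> \<psi> \<in> l ! j"
            then show ?thesis using dia[of k j \<psi>] k ij by simp
          next
            assume "\<exists>m. j < m \<and> m < length l \<and> path_sat True p (drop m l) \<psi>"
            then show ?thesis using late less_imp_le by blast
          qed
        next
          case 3
          then show ?thesis using late m by blast
        qed
      qed blast
    qed
    moreover have "?l' ! k = l ! k" "k < length ?l'" "k < length l"
      using k ij by (simp_all add: nth_append)
    ultimately show ?thesis
      using path_sat_dia[of k ?l'] path_sat_dia[of k l] by blast
  qed
next
  case (Neg \<psi>)
  then show ?case using subs_closed(1)[OF Neg.prems(1)] by simp
next
  case (And \<psi> \<chi>)
  then show ?case using subs_closed(2)[OF And.prems(1)] by simp
next
  case (Or \<psi> \<chi>)
  then show ?case using subs_closed(3)[OF Or.prems(1)] by simp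
next
  case (Imp \<psi> \<chi>)
  then show ?case using subs_closed(4)[OF Imp.prems(1)] by simp
qed simp_all

text \<open>Pigeonhole: on a long path two non-initial positions agree on all subformulas, and
  \<open>path_sat_cut\<close> removes what lies between them. Induction on the length repeats
  this.\<close>

lemma short_marked_path:
  assumes "transp R"
    and "b \<noteq> []" "hd b = w" "successively R b" "V (last b) p" "path_sat True p (map (tp R V \<phi> p) b) \<phi>"
  obtains b' where "b' \<noteq> []" "hd b' = w" "successively R b'" "V (last b') p"
    "path_sat True p (map (tp R V \<phi> p) b') \<phi>" "length b' \<le> Suc (card (Pow (set (subs \<phi>))))"
  using assms(2-)
proof (induction "length b" arbitrary: b thesis rule: less_induct)
  case less
  let ?l = "map (tp R V \<phi> p) b" and ?S = "Pow (set (subs \<phi>))"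
  define f where "f k = {\<psi> \<in> set (subs \<phi>). path_sat True p (drop k ?l) \<psi>}" for k
  show ?case
  proof (cases "length b \<le> Suc (card ?S)")
    case True
    then show ?thesis using less.prems by blast
  next
    case False
    \<comment> \<open>Position 0 is left out so that cutting keeps the first world \<open>w\<close>;
      this accounts for the \<open>Suc\<close> in the bound.\<close>
    have "\<not> inj_on f {1..<length b}"
    proof
      assume "inj_on f {1..<length b}"
      then have "card {1..<length b} \<le> card ?S"
        by (rule card_inj_on_le) (auto simp: f_def)
      with False show False by simp
    qed
    then obtain i j where *: "i \<in> {1..<length b}" "j \<in> {1..<length b}" "f i = f j" "i \<noteq> j"
      unfolding inj_on_def by blast
    obtain i j where ij: "0 < i" "i < j" "j < length b" "f i = f j"
      using that[of i j] that[of j i] * by (cases "i < j") (auto simp: Suc_le_eq)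
    let ?b = "take i b @ drop j b"
    have sorted: "sorted_wrt R b"
      using less.prems(4) assms(1) by (simp add: successively_conv_sorted_wrt)
    have "path_sat True p (drop 0 (take i ?l @ drop j ?l)) \<phi> = path_sat True p (drop 0 ?l) \<phi>"
    proof (rule path_sat_cut[OF ij(1,2) _ _ _ subs_self])
      show "path_sat True p (drop i ?l) \<psi> = path_sat True p (drop j ?l) \<psi>"
        if "\<psi> \<in> set (subs \<phi>)" for \<psi>
        using ij(4) that unfolding f_def by blast
      \<comment> \<open>Here transitivity enters: whatever a later world of the path sees is also
        seen by the earlier ones.\<close>
      show "\<^bold>\<diamond> \<psi> \<in> ?l ! k" if "k \<le> m" "m < length ?l" "\<^bold>\<diamond> \<psi> \<in> ?l ! m" for k m \<psi>
      proof (cases "k = m")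
        case False
        then have "R (b ! k) (b ! m)"
          using sorted that by (simp add: sorted_wrt_iff_nth_less)
        moreover have "k < length b" "m < length b" "\<^bold>\<diamond> \<psi> \<in> tp R V \<phi> p (b ! m)" using that by auto
        ultimately show ?thesis
          using transpD[OF assms(1)] unfolding tp_def by auto
      qed (use that in simp)
    qed (use ij in auto)
    then have "path_sat True p (map (tp R V \<phi> p) ?b) \<phi>"
      using less.prems(6) by (simp add: take_map drop_map)
    moreover have "?b \<noteq> []" "hd ?b = w" "V (last ?b) p" "length ?b < length b"
      using ij less.prems(2,3,5) by auto
    \<comment> \<open>The entries of \<open>take i b\<close> are among those of
      \<open>take j b\<close>, which are related to all of \<open>drop j b\<close>; so the two
      pieces join to a path.\<close>
    moreover have "sorted_wrt R (take i b @ drop i b)" "sorted_wrt R (take j b @ drop j b)"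
      using sorted by simp_all
    then have "sorted_wrt R ?b"
      unfolding sorted_wrt_append using ij(2) set_take_subset_set_take[of i j b] by auto
    then have "successively R ?b"
      by (rule successively_if_sorted_wrt)
    ultimately show ?thesis
      using less.hyps[of ?b] less.prems(1) by blast
  qed
qed

section \<open>The characterization\<close>

lemma sat_mark_Fm: "\<kappa> \<in> Fm X \<Longrightarrow> p \<notin> X \<Longrightarrow> sat R (mark V p A) w \<kappa> = sat R V w \<kappa>"
  by (rule sat_cong) (auto simp: Fm_def mark_def)

text \<open>Marking leaves the formulas in \<open>Fm X\<close> alone, and both \<diamond> and
  conjunction with a fixed formula distribute over disjunction.\<close>

lemma sat_delta_additive:
  assumes "p \<notin> X"
  shows "\<kappa> \<in> Fm X \<Longrightarrow> set \<kappa>s \<subseteq> Fm X \<Longrightarrow> sat R (mark V p (A \<union> B)) w (delta p \<kappa> \<kappa>s) \<longleftrightarrow>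
    sat R (mark V p A) w (delta p \<kappa> \<kappa>s) \<or> sat R (mark V p B) w (delta p \<kappa> \<kappa>s)"
proof (induction \<kappa>s arbitrary: \<kappa> w)
  case Nil
  then show ?case using assms by (auto simp: sat_mark_Fm) (auto simp: mark_def)
next
  case (Cons \<kappa>' \<kappa>s)
  then show ?case using assms by (auto simp: sat_mark_Fm)
qed

lemma sat_A0_additive:
  assumes "\<psi> \<in> A0 p X" "p \<notin> X"
  shows "sat R (mark V p (A \<union> B)) w \<psi> \<longleftrightarrow> sat R (mark V p A) w \<psi> \<or> sat R (mark V p B) w \<psi>"
proof -
  obtain \<delta>s \<kappa> where \<psi>: "\<psi> = Disj \<delta>s \<^bold>\<or> \<kappa>" "set \<delta>s \<subseteq> Delta p X" "\<kappa> \<in> Fm X"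
    using assms(1) unfolding A0_def by blast
  have "sat R (mark V p (A \<union> B)) w \<delta> \<longleftrightarrow> sat R (mark V p A) w \<delta> \<or> sat R (mark V p B) w \<delta>"
    if "\<delta> \<in> set \<delta>s" for \<delta>
  proof -
    from that \<psi>(2) obtain \<kappa>' \<kappa>s where "\<delta> = delta p \<kappa>' \<kappa>s" "\<kappa>' \<in> Fm X" "set \<kappa>s \<subseteq> Fm X"
      unfolding Delta_def by blast
    then show ?thesis using sat_delta_additive[OF assms(2)] by simp
  qed
  then show ?thesis
    unfolding \<psi>(1) sat.simps sat_Disj sat_mark_Fm[OF \<psi>(3) assms(2)] by blast
qed

text \<open>Soundness carries the equivalence to all models, where additivity is read off \<psi>;
  completeness turns it back into a theorem.\<close>

lemma additive_if_equivalent_A0: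
  assumes "p \<noteq> q" "p \<notin> X" "q \<notin> vars \<phi>" "\<psi> \<in> A0 p X" "equivalent (logic g) \<phi> \<psi>"
  shows "additive (logic g) p q \<phi>"
  unfolding additive_def
proof (rule finite_completeness)
  fix R :: "fm set \<Rightarrow> fm set \<Rightarrow> bool" and V w
  assume "okframe g R"
  then have "sat R V' w (\<phi> \<^bold>\<longleftrightarrow> \<psi>)" for V'
    by (rule soundness[OF assms(5)[unfolded equivalent_def]])
  then have "sat R V' w \<phi> \<longleftrightarrow> sat R V' w \<psi>" for V'
    by auto
  then show "sat R V w (subst (Var(p := Var p \<^bold>\<or> Var q)) \<phi> \<^bold>\<longleftrightarrow> \<phi> \<^bold>\<or> subst (Var(p := Var q)) \<phi>)"
    unfolding sat_additive_fm[OF assms(1,3)] using sat_A0_additive[OF assms(4,2)] by simp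
qed

lemma equivalent_A0_if_additive:
  assumes pq: "p \<noteq> q" "q \<notin> vars \<phi>" and vars: "vars \<phi> \<subseteq> insert p X"
    and add: "additive (logic g) p q \<phi>"
  shows "\<exists>\<psi>\<in>A0 p X. equivalent (logic g) \<phi> \<psi>"
proof -
  define \<chi> where "\<chi> = unbox \<phi>"
  have sat_\<chi>: "sat R V w \<chi> = sat R V w \<phi>" for R :: "fm set \<Rightarrow> fm set \<Rightarrow> bool" and V w
    unfolding \<chi>_def by (rule sat_unbox)
  have vars_\<chi>: "vars \<chi> \<subseteq> insert p X"
    using vars unfolding \<chi>_def vars_unbox .
  have nobox: "\<^bold>\<box> \<psi> \<notin> set (subs \<chi>)" for \<psi>
    unfolding \<chi>_def by (rule box_notin_subs_unbox)
  let ?S = "Pow (set (subs \<chi>))"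
  \<comment> \<open>The sum of the bounds for K and for GL, so that one finite set \<open>?L\<close>
    serves both logics.\<close>
  let ?N = "Suc (depth \<chi>) + Suc (card ?S)"
  let ?L = "{l. l \<noteq> [] \<and> set l \<subseteq> ?S \<and> length l \<le> ?N \<and> path_sat g p l \<chi>}"
  \<comment> \<open>This disjunct covers the case that \<chi> holds already with \<open>p\<close>
    false everywhere.\<close>
  let ?\<kappa> = "subst (Var(p := \<^bold>\<bottom>)) \<chi>"
  have finite_L: "finite ?L"
    by (rule finite_subset[OF _ finite_lists_length_le[of ?S ?N]]) auto
  obtain \<delta>s where \<delta>s: "set \<delta>s = delta_of \<chi> p ` ?L" "distinct \<delta>s"
    using finite_distinct_list[OF finite_imageI[OF finite_L, of "delta_of \<chi> p"]]
    by (elim exE conjE) (rule that)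
  have "?\<kappa> \<in> Fm X"
    using vars_\<chi> unfolding Fm_def mem_Collect_eq vars_subst_bot by blast
  moreover have "set \<delta>s \<subseteq> Delta p X"
    unfolding \<delta>s(1) using delta_of_in_Delta[OF vars_\<chi>] by auto
  ultimately have "Disj \<delta>s \<^bold>\<or> ?\<kappa> \<in> A0 p X"
    unfolding A0_def using \<delta>s(2) by blast
  moreover have "equivalent (logic g) \<phi> (Disj \<delta>s \<^bold>\<or> ?\<kappa>)"
    unfolding equivalent_def
  proof (rule finite_completeness)
    fix R :: "fm set \<Rightarrow> fm set \<Rightarrow> bool" and V W w
    assume ok: "okframe g R" and W: "finite W" "w \<in> W" "\<And>u v. R u v \<Longrightarrow> v \<in> W"
    \<comment> \<open>Soundness holds over every type of worlds, so additivity is available in the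
      unravelling too.\<close>
    have add_\<chi>: "sat (unravel g R) (mark U p (A \<union> B)) x \<chi> \<longleftrightarrow>
        sat (unravel g R) (mark U p A) x \<chi> \<or> sat (unravel g R) (mark U p B) x \<chi>" for U A B x
      unfolding \<chi>_def sat_unbox by (rule additive_sat[OF add pq okframe_unravel[OF ok]])
    have "sat R V w (Disj \<delta>s) \<or> sat R (mark V p {}) w \<chi>" if sat: "sat R V w \<chi>"
    proof (rule disjCI)
      assume "\<not> sat R (mark V p {}) w \<chi>"
      from sat_imp_marked_path[OF ok nobox add_\<chi> W sat this]
      obtain b where b: "b \<noteq> []" "hd b = w" "successively R b" "V (last b) p"
        "path_sat g p (map (tp R V \<chi> p) b) \<chi>" "\<not> g \<longrightarrow> length b \<le> Suc (depth \<chi>)" .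
      obtain b' where b': "b' \<noteq> []" "hd b' = w" "successively R b'" "V (last b') p"
        "path_sat g p (map (tp R V \<chi> p) b') \<chi>" "length b' \<le> ?N"
      proof (cases g)
        case True
        with ok have trans: "transp R" unfolding okframe_def by blast
        have "path_sat True p (map (tp R V \<chi> p) b) \<chi>" using b(5) True by simp
        then obtain b' where "b' \<noteq> []" "hd b' = w" "successively R b'" "V (last b') p"
          "path_sat True p (map (tp R V \<chi> p) b') \<chi>" "length b' \<le> Suc (card ?S)"
          by (rule short_marked_path[where V = V and p = p, OF trans b(1-4)])
        with True show thesis by (intro that, simp_all) linarith
      next
        case False
        with b show thesis by (intro that, simp_all) linarith
      qed
      let ?l = "map (tp R V \<chi> p) b'"
      have l: "?l \<noteq> []" "set ?l \<subseteq> ?S"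
        using b'(1) unfolding tp_def by auto
      have "sat R V w (delta_of \<chi> p ?l)"
        unfolding sat_delta_of[OF l] by (intro exI[of _ b'] conjI refl b')
      moreover have "?l \<in> ?L"
        using l b'(5,6) by simp
      ultimately show "sat R V w (Disj \<delta>s)"
        unfolding sat_Disj \<delta>s(1) by blast
    qed
    moreover have "sat R V w \<chi>" if "sat R V w (Disj \<delta>s)"
    proof -
      from that obtain l where "l \<in> ?L" "sat R V w (delta_of \<chi> p l)"
        unfolding sat_Disj \<delta>s(1) by blast
      then show ?thesis
        using sat_delta_of_imp[OF ok nobox add_\<chi>, of l V w] by simp
    qed
    moreover have "sat R V w \<chi>" if "sat R (mark V p {}) w \<chi>"
    proof -
      \<comment> \<open>Additivity yields monotonicity: passing from no marks to the actual
        extension of \<open>p\<close> preserves truth.\<close>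
      have "sat R (mark V p ({} \<union> {u. V u p})) w \<chi>"
        using that additive_sat[OF add pq ok] unfolding sat_\<chi> by blast
      then show ?thesis by (simp add: mark_self)
    qed
    ultimately show "sat R V w (\<phi> \<^bold>\<longleftrightarrow> Disj \<delta>s \<^bold>\<or> ?\<kappa>)"
      unfolding sat.simps sat_subst_bot sat_\<chi>[symmetric] by blast
  qed
  ultimately show ?thesis by blast
qed

theorem theorem5p6:
  fixes \<Lambda> :: "fm set" and p q :: nat and r :: "nat list" and \<phi> :: fm
  assumes "\<Lambda> \<in> {logic_K, logic_GL}"
    and "p \<noteq> q" and "p \<notin> set r" and "q \<notin> set r"
    and "\<phi> \<in> Fm (insert p (set r))"
  shows "additive \<Lambda> p q \<phi> \<longleftrightarrow> (\<exists>\<psi> \<in> A0 p (set r). equivalent \<Lambda> \<phi> \<psi>)"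
proof -
  obtain g where \<Lambda>: "\<Lambda> = logic g"
    using assms(1) unfolding logic_def by (metis (full_types) insert_iff singletonD)
  have vars: "vars \<phi> \<subseteq> insert p (set r)" "q \<notin> vars \<phi>"
    using assms(2,4,5) unfolding Fm_def by auto
  show ?thesis
    unfolding \<Lambda>
  proof
    assume "additive (logic g) p q \<phi>"
    then show "\<exists>\<psi>\<in>A0 p (set r). equivalent (logic g) \<phi> \<psi>"
      by (rule equivalent_A0_if_additive[OF assms(2) vars(2,1)])
  next
    assume "\<exists>\<psi>\<in>A0 p (set r). equivalent (logic g) \<phi> \<psi>"
    then show "additive (logic g) p q \<phi>"
      using additive_if_equivalent_A0[OF assms(2,3) vars(2)] by blast
  qed
qed

end
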